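(* Let $V$ be a finite dimensional $\mathbf{k}$-vector space with basis $\{v_1,\ldots,v_N\}$, let $\gamma\colon V^{\otimes 2}\to V^{\otimes 2}$ be an $R$-matrix with structure constants $c_{ij}^{mn}$ given by $\gamma(v_i\otimes v_j)=\sum_{m,n=1}^N c_{ij}^{mn}v_m\otimes v_n$, and let $A(\gamma)$ be the FRT quantum group associated to $\gamma$, with generators $T_i^j$, comultiplication $\Delta$ and cobraiding form $R$. Let $\lambda_1,\ldots,\lambda_N\in\mathbf{k}$ be invertible scalars such that $$\lambda_i\lambda_jc_{ij}^{mn}=\lambda_m\lambda_nc_{ij}^{mn}\quad\text{for all } i,j,m,n\in\{1,\ldots,N\}.$$ Then the following statements hold. (1) There is a bialgebra morphism $\alpha_A\colon A(\gamma)\to A(\gamma)$ determined by $\alpha_A(T_i^j)=\lambda_i\lambda_j^{-1}T_i^j$ for all $i$ and $j$. (2) The bilinear form $R$ on $A(\gamma)$ satisfies $R=R\circ\alpha_A^{\otimes 2}$. (3) Let $\alpha_V\colon V\to V$ be the linear map defined by $\alpha_V(v_i)=\lambda_iv_i$ for all $i$. Then $$(\alpha_A\otimes\alpha_V)\circ\rho=\rho\circ\alpha_V\quad\text{and}\quad \alpha_V^{\otimes 2}\circ\gamma=\gamma\circ\alpha_V^{\otimes 2},$$ where $\rho\colon V\to A(\gamma)\otimes V$ is the $A(\gamma)$-comodule structure map $\rho(v_i)=\sum_{k=1}^N T_i^k\otimes v_k$.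
   Context: $\mathbf{k}$ is a field of characteristic $0$; tensor products and linear maps are over $\mathbf{k}$. An $R$-matrix on $V$ is a linear automorphism $\gamma$ of $V^{\otimes 2}$ with $(\mathrm{Id}\otimes\gamma)\circ(\gamma\otimes\mathrm{Id})\circ(\mathrm{Id}\otimes\gamma)=(\gamma\otimes\mathrm{Id})\circ(\mathrm{Id}\otimes\gamma)\circ(\gamma\otimes\mathrm{Id})$ on $V^{\otimes 3}$. The FRT quantum group $A(\gamma)$: let $\{T_i^j\}_{1\le i,j\le N}$ be $N^2$ independent non-commuting variables, and let $A(\gamma)$ be the unital associative $\mathbf{k}$-algebra generated by the $T_i^j$ subject to the relations, for all $i,j,m,n\in\{1,\ldots,N\}$, $$\sum_{k,l=1}^N c_{ij}^{kl}T_k^mT_l^n-\sum_{k,l=1}^N T_i^kT_j^lc_{kl}^{mn}=0.$$ It is a bialgebra with comultiplication the algebra morphism determined by $\Delta(T_i^j)=\sum_{k=1}^N T_i^k\otimes T_k^j$. It is a cobraided bialgebra with the bilinear form $R\colon A(\gamma)^{\otimes 2}\to\mathbf{k}$ determined by $R(T_i^m\otimes T_j^n)=c_{ji}^{mn}$ and $R(1\otimes T_i^j)=R(T_i^j\otimes 1)=\delta_{ij}$, and extended to all of $A(\gamma)^{\otimes 2}$ by the rules $R(xy\otimes z)=\sum R(x\otimes z_1)R(y\otimes z_2)$ and $R(x\otimes yz)=\sum R(x_1\otimes z)R(x_2\otimes y)$, where $\Delta(x)=\sum x_1\otimes x_2$. (That $A(\gamma)$ is a well-defined cobraided bialgebra,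 i.e. that $R$ is well defined and also satisfies $\sum y_1x_1R(x_2\otimes y_2)=\sum R(x_1\otimes y_1)x_2y_2$, is a known fact.) *)

theory Defs
  imports "Jordan_Normal_Form.Missing_VectorSpace" "HOL-Algebra.QuotRing"
begin

text \<open>
  A unital, not necessarily commutative \<open>K\<close>-algebra is a \<open>module\<close> record whose ring part is used as
  well; for mere vector spaces the fields \<open>mult\<close> and \<open>one\<close> of the record carry no meaning. (The library
  locale \<open>algebra\<close> is restricted to commutative algebras.)
\<close>

section \<open>Free modules, quotients and linear maps\<close>

definition unit_vec_at :: "('k, 'c) ring_scheme \<Rightarrow> 'x \<Rightarrow> 'x \<Rightarrow> 'k" where
  "unit_vec_at K p = (\<lambda>q. if q = p then \<one>\<^bsub>K\<^esub> else \<zero>\<^bsub>K\<^esub>)"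

definition free_module :: "('k, 'c) ring_scheme \<Rightarrow> 'x set \<Rightarrow> ('k, 'x \<Rightarrow> 'k) module" where
  "free_module K S =
    \<lparr>carrier = {f. f \<in> S \<rightarrow> carrier K \<and> (\<forall>p. p \<notin> S \<longrightarrow> f p = \<zero>\<^bsub>K\<^esub>) \<and> finite {p. f p \<noteq> \<zero>\<^bsub>K\<^esub>}},
     mult = undefined,
     one = undefined,
     zero = (\<lambda>p. \<zero>\<^bsub>K\<^esub>),
     add = (\<lambda>f g p. f p \<oplus>\<^bsub>K\<^esub> g p),
     smult = (\<lambda>a f p. a \<otimes>\<^bsub>K\<^esub> f p)\<rparr>"

text \<open>The value at \<open>f\<close> of the linear map on a free module that sends the basis vector \<open>p\<close> to \<open>b p\<close>.\<close>

definition linear_extension ::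
  "('k, 'c) ring_scheme \<Rightarrow> ('k, 'm, 'd) module_scheme \<Rightarrow> ('x \<Rightarrow> 'm) \<Rightarrow> ('x \<Rightarrow> 'k) \<Rightarrow> 'm" where
  "linear_extension K M b f = (\<Oplus>\<^bsub>M\<^esub>p\<in>{p. f p \<noteq> \<zero>\<^bsub>K\<^esub>}. f p \<odot>\<^bsub>M\<^esub> b p)"

text \<open>
  The quotient \<open>M/H\<close>, with the ring part of the library quotient. It is used both for a submodule
  \<open>H\<close> (where the multiplication is meaningless) and for a two-sided ideal \<open>H\<close> of an algebra. The
  image of a coset under scalar multiplication by \<open>0\<close> is the single point \<open>0\<close>, hence the
  translation by \<open>H\<close> in \<open>smult\<close>.
\<close>

definition quot_module :: "('k, 'm, 'd) module_scheme \<Rightarrow> 'm set \<Rightarrow> ('k, 'm set) module" where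
  "quot_module M H =
    \<lparr>carrier = carrier (M Quot H),
     mult = mult (M Quot H),
     one = one (M Quot H),
     zero = zero (M Quot H),
     add = add (M Quot H),
     smult = (\<lambda>a X. \<Union>x\<in>X. H +>\<^bsub>M\<^esub> (a \<odot>\<^bsub>M\<^esub> x))\<rparr>"

definition self_module :: "('k, 'c) ring_scheme \<Rightarrow> ('k, 'k) module" where
  "self_module K =
    \<lparr>carrier = carrier K, mult = mult K, one = one K, zero = zero K, add = add K, smult = mult K\<rparr>"

definition algebra_hom ::
  "('k, 'c) ring_scheme \<Rightarrow> ('k, 'a, 'd) module_scheme \<Rightarrow> ('k, 'b, 'e) module_scheme \<Rightarrow> ('a \<Rightarrow> 'b) set"
  where "algebra_hom K A B = module_hom K A B \<inter> ring_hom A B"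


section \<open>Tensor products\<close>

text \<open>
  The tensor product over \<open>K\<close> is the free module on \<open>carrier U \<times> carrier W\<close> modulo the span of the
  bilinearity relators.
\<close>

definition bilinear_relators ::
  "('k, 'c) ring_scheme \<Rightarrow> ('k, 'u, 'd) module_scheme \<Rightarrow> ('k, 'w, 'e) module_scheme
    \<Rightarrow> ('u \<times> 'w \<Rightarrow> 'k) set" where
  "bilinear_relators K U W =
    (let F = free_module K (carrier U \<times> carrier W); e = unit_vec_at K in
       {e (u \<oplus>\<^bsub>U\<^esub> u', w) \<ominus>\<^bsub>F\<^esub> (e (u, w) \<oplus>\<^bsub>F\<^esub> e (u', w)) | u u' w.
          u \<in> carrier U \<and> u' \<in> carrier U \<and> w \<in> carrier W}
     \<union> {e (u, w \<oplus>\<^bsub>W\<^esub> w') \<ominus>\<^bsub>F\<^esub> (e (u, w) \<oplus>\<^bsub>F\<^esub> e (u, w')) | u w w'.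
          u \<in> carrier U \<and> w \<in> carrier W \<and> w' \<in> carrier W}
     \<union> {e (a \<odot>\<^bsub>U\<^esub> u, w) \<ominus>\<^bsub>F\<^esub> a \<odot>\<^bsub>F\<^esub> e (u, w) | a u w.
          a \<in> carrier K \<and> u \<in> carrier U \<and> w \<in> carrier W}
     \<union> {e (u, a \<odot>\<^bsub>W\<^esub> w) \<ominus>\<^bsub>F\<^esub> a \<odot>\<^bsub>F\<^esub> e (u, w) | a u w.
          a \<in> carrier K \<and> u \<in> carrier U \<and> w \<in> carrier W})"

definition tensor_kernel ::
  "('k, 'c) ring_scheme \<Rightarrow> ('k, 'u, 'd) module_scheme \<Rightarrow> ('k, 'w, 'e) module_scheme
    \<Rightarrow> ('u \<times> 'w \<Rightarrow> 'k) set" where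
  "tensor_kernel K U W =
    module.span K (free_module K (carrier U \<times> carrier W)) (bilinear_relators K U W)"

definition tensor ::
  "('k, 'c) ring_scheme \<Rightarrow> ('k, 'u, 'd) module_scheme \<Rightarrow> ('k, 'w, 'e) module_scheme
    \<Rightarrow> ('k, ('u \<times> 'w \<Rightarrow> 'k) set) module" where
  "tensor K U W = quot_module (free_module K (carrier U \<times> carrier W)) (tensor_kernel K U W)"

definition pure_tensor ::
  "('k, 'c) ring_scheme \<Rightarrow> ('k, 'u, 'd) module_scheme \<Rightarrow> ('k, 'w, 'e) module_scheme
    \<Rightarrow> 'u \<Rightarrow> 'w \<Rightarrow> ('u \<times> 'w \<Rightarrow> 'k) set" where
  "pure_tensor K U W u w =
    tensor_kernel K U W +>\<^bsub>free_module K (carrier U \<times> carrier W)\<^esub> unit_vec_at K (u, w)"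

text \<open>
  The linear map into \<open>M\<close> induced by a bilinear map \<open>b\<close>. If \<open>b\<close> is bilinear, the linear extension
  of \<open>b\<close> is constant on cosets, so that the image of a coset is a singleton.
\<close>

definition tensor_lift ::
  "('k, 'c) ring_scheme \<Rightarrow> ('k, 'm, 'd) module_scheme \<Rightarrow> ('u \<Rightarrow> 'w \<Rightarrow> 'm)
    \<Rightarrow> ('u \<times> 'w \<Rightarrow> 'k) set \<Rightarrow> 'm" where
  "tensor_lift K M b X = the_elem (linear_extension K M (\<lambda>p. b (fst p) (snd p)) ` X)"

text \<open>\<open>tensor_map K U' W' f g\<close> is \<open>f \<otimes> g\<close>, where \<open>U'\<close> and \<open>W'\<close> are the codomains of \<open>f\<close> and \<open>g\<close>.\<close>

definition tensor_map ::
  "('k, 'c) ring_scheme \<Rightarrow> ('k, 'u', 'd) module_scheme \<Rightarrow> ('k, 'w', 'e) module_scheme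
    \<Rightarrow> ('u \<Rightarrow> 'u') \<Rightarrow> ('w \<Rightarrow> 'w') \<Rightarrow> ('u \<times> 'w \<Rightarrow> 'k) set \<Rightarrow> ('u' \<times> 'w' \<Rightarrow> 'k) set" where
  "tensor_map K U' W' f g =
    tensor_lift K (tensor K U' W') (\<lambda>u w. pure_tensor K U' W' (f u) (g w))"

definition tensor_algebra ::
  "('k, 'c) ring_scheme \<Rightarrow> ('k, 'a, 'd) module_scheme \<Rightarrow> ('k, 'b, 'e) module_scheme
    \<Rightarrow> ('k, ('a \<times> 'b \<Rightarrow> 'k) set) module" where
  "tensor_algebra K A B =
    (tensor K A B)
      \<lparr>mult := (\<lambda>X Y.
         tensor_lift K (tensor K A B) (\<lambda>a b.
           tensor_lift K (tensor K A B) (\<lambda>a' b'.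
             pure_tensor K A B (a \<otimes>\<^bsub>A\<^esub> a') (b \<otimes>\<^bsub>B\<^esub> b')) Y) X),
       one := pure_tensor K A B \<one>\<^bsub>A\<^esub> \<one>\<^bsub>B\<^esub>\<rparr>"

text \<open>The associativity isomorphisms \<open>(U \<otimes> V) \<otimes> W \<rightarrow> U \<otimes> (V \<otimes> W)\<close> and back.\<close>

definition tensor_assoc ::
  "('k, 'c) ring_scheme \<Rightarrow> ('k, 'u, 'd) module_scheme \<Rightarrow> ('k, 'v, 'e) module_scheme
    \<Rightarrow> ('k, 'w, 'f) module_scheme
    \<Rightarrow> (('u \<times> 'v \<Rightarrow> 'k) set \<times> 'w \<Rightarrow> 'k) set \<Rightarrow> ('u \<times> ('v \<times> 'w \<Rightarrow> 'k) set \<Rightarrow> 'k) set" where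
  "tensor_assoc K U V W =
    (let T = tensor K U (tensor K V W) in
     tensor_lift K T (\<lambda>s w.
       tensor_lift K T (\<lambda>u v. pure_tensor K U (tensor K V W) u (pure_tensor K V W v w)) s))"

definition tensor_assoc_inv ::
  "('k, 'c) ring_scheme \<Rightarrow> ('k, 'u, 'd) module_scheme \<Rightarrow> ('k, 'v, 'e) module_scheme
    \<Rightarrow> ('k, 'w, 'f) module_scheme
    \<Rightarrow> ('u \<times> ('v \<times> 'w \<Rightarrow> 'k) set \<Rightarrow> 'k) set \<Rightarrow> (('u \<times> 'v \<Rightarrow> 'k) set \<times> 'w \<Rightarrow> 'k) set" where
  "tensor_assoc_inv K U V W =
    (let T = tensor K (tensor K U V) W in
     tensor_lift K T (\<lambda>u s.
       tensor_lift K T (\<lambda>v w. pure_tensor K (tensor K U V) W (pure_tensor K U V u v) w) s))"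


section \<open>R-matrices\<close>

text \<open>The threefold tensor power of \<open>V\<close> is bracketed as \<open>(V \<otimes> V) \<otimes> V\<close>.\<close>

definition R_left ::
  "('k, 'c) ring_scheme \<Rightarrow> ('k, 'v, 'd) module_scheme
    \<Rightarrow> (('v \<times> 'v \<Rightarrow> 'k) set \<Rightarrow> ('v \<times> 'v \<Rightarrow> 'k) set)
    \<Rightarrow> (('v \<times> 'v \<Rightarrow> 'k) set \<times> 'v \<Rightarrow> 'k) set \<Rightarrow> (('v \<times> 'v \<Rightarrow> 'k) set \<times> 'v \<Rightarrow> 'k) set" where
  "R_left K V \<gamma> = tensor_map K (tensor K V V) V \<gamma> (\<lambda>x. x)"

definition R_right ::
  "('k, 'c) ring_scheme \<Rightarrow> ('k, 'v, 'd) module_scheme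
    \<Rightarrow> (('v \<times> 'v \<Rightarrow> 'k) set \<Rightarrow> ('v \<times> 'v \<Rightarrow> 'k) set)
    \<Rightarrow> (('v \<times> 'v \<Rightarrow> 'k) set \<times> 'v \<Rightarrow> 'k) set \<Rightarrow> (('v \<times> 'v \<Rightarrow> 'k) set \<times> 'v \<Rightarrow> 'k) set" where
  "R_right K V \<gamma> =
    tensor_assoc_inv K V V V \<circ> tensor_map K V (tensor K V V) (\<lambda>x. x) \<gamma> \<circ> tensor_assoc K V V V"

definition R_matrix ::
  "('k, 'c) ring_scheme \<Rightarrow> ('k, 'v, 'd) module_scheme
    \<Rightarrow> (('v \<times> 'v \<Rightarrow> 'k) set \<Rightarrow> ('v \<times> 'v \<Rightarrow> 'k) set) \<Rightarrow> bool" where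
  "R_matrix K V \<gamma> \<longleftrightarrow>
    \<gamma> \<in> module_hom K (tensor K V V) (tensor K V V) \<and>
    bij_betw \<gamma> (carrier (tensor K V V)) (carrier (tensor K V V)) \<and>
    (\<forall>t\<in>carrier (tensor K (tensor K V V) V).
       R_right K V \<gamma> (R_left K V \<gamma> (R_right K V \<gamma> t)) =
       R_left K V \<gamma> (R_right K V \<gamma> (R_left K V \<gamma> t)))"

definition is_structure_constants ::
  "('k, 'c) ring_scheme \<Rightarrow> ('k, 'v, 'd) module_scheme \<Rightarrow> nat \<Rightarrow> (nat \<Rightarrow> 'v)
    \<Rightarrow> (('v \<times> 'v \<Rightarrow> 'k) set \<Rightarrow> ('v \<times> 'v \<Rightarrow> 'k) set)
    \<Rightarrow> (nat \<Rightarrow> nat \<Rightarrow> nat \<Rightarrow> nat \<Rightarrow> 'k) \<Rightarrow> bool" where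
  "is_structure_constants K V N v \<gamma> c \<longleftrightarrow>
    (\<forall>i\<in>{1..N}. \<forall>j\<in>{1..N}.
       (\<forall>m\<in>{1..N}. \<forall>n\<in>{1..N}. c i j m n \<in> carrier K) \<and>
       \<gamma> (pure_tensor K V V (v i) (v j)) =
         (\<Oplus>\<^bsub>tensor K V V\<^esub>m\<in>{1..N}. \<Oplus>\<^bsub>tensor K V V\<^esub>n\<in>{1..N}.
            c i j m n \<odot>\<^bsub>tensor K V V\<^esub> pure_tensor K V V (v m) (v n)))"


section \<open>The FRT quantum group\<close>

text \<open>The free unital associative algebra on a set \<open>S\<close> of variables; its basis consists of the words over \<open>S\<close>.\<close>

definition free_algebra :: "('k, 'c) ring_scheme \<Rightarrow> 'x set \<Rightarrow> ('k, 'x list \<Rightarrow> 'k) module" where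
  "free_algebra K S =
    (free_module K (lists S))
      \<lparr>mult := (\<lambda>f g w. \<Oplus>\<^bsub>K\<^esub>i\<in>{..length w}. f (take i w) \<otimes>\<^bsub>K\<^esub> g (drop i w)),
       one := unit_vec_at K []\<rparr>"

text \<open>
  The variable \<open>T_i^j\<close> is the pair \<open>(i, j)\<close>, and \<open>c i j m n\<close> stands for \<open>c_{ij}^{mn}\<close>.
\<close>

definition frt_free :: "('k, 'c) ring_scheme \<Rightarrow> nat \<Rightarrow> ('k, (nat \<times> nat) list \<Rightarrow> 'k) module" where
  "frt_free K N = free_algebra K ({1..N} \<times> {1..N})"

definition frt_var :: "('k, 'c) ring_scheme \<Rightarrow> nat \<Rightarrow> nat \<Rightarrow> (nat \<times> nat) list \<Rightarrow> 'k" where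
  "frt_var K i j = unit_vec_at K [(i, j)]"

definition frt_relators ::
  "('k, 'c) ring_scheme \<Rightarrow> nat \<Rightarrow> (nat \<Rightarrow> nat \<Rightarrow> nat \<Rightarrow> nat \<Rightarrow> 'k)
    \<Rightarrow> ((nat \<times> nat) list \<Rightarrow> 'k) set" where
  "frt_relators K N c =
    (let F = frt_free K N; X = frt_var K in
     {(\<Oplus>\<^bsub>F\<^esub>k\<in>{1..N}. \<Oplus>\<^bsub>F\<^esub>l\<in>{1..N}. c i j k l \<odot>\<^bsub>F\<^esub> (X k m \<otimes>\<^bsub>F\<^esub> X l n))
        \<ominus>\<^bsub>F\<^esub> (\<Oplus>\<^bsub>F\<^esub>k\<in>{1..N}. \<Oplus>\<^bsub>F\<^esub>l\<in>{1..N}. c k l m n \<odot>\<^bsub>F\<^esub> (X i k \<otimes>\<^bsub>F\<^esub> X j l))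
      | i j m n. i \<in> {1..N} \<and> j \<in> {1..N} \<and> m \<in> {1..N} \<and> n \<in> {1..N}})"

definition frt_ideal ::
  "('k, 'c) ring_scheme \<Rightarrow> nat \<Rightarrow> (nat \<Rightarrow> nat \<Rightarrow> nat \<Rightarrow> nat \<Rightarrow> 'k)
    \<Rightarrow> ((nat \<times> nat) list \<Rightarrow> 'k) set" where
  "frt_ideal K N c = Idl\<^bsub>frt_free K N\<^esub> (frt_relators K N c)"

definition frt ::
  "('k, 'c) ring_scheme \<Rightarrow> nat \<Rightarrow> (nat \<Rightarrow> nat \<Rightarrow> nat \<Rightarrow> nat \<Rightarrow> 'k)
    \<Rightarrow> ('k, ((nat \<times> nat) list \<Rightarrow> 'k) set) module" where
  "frt K N c = quot_module (frt_free K N) (frt_ideal K N c)"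

definition frt_gen ::
  "('k, 'c) ring_scheme \<Rightarrow> nat \<Rightarrow> (nat \<Rightarrow> nat \<Rightarrow> nat \<Rightarrow> nat \<Rightarrow> 'k)
    \<Rightarrow> nat \<Rightarrow> nat \<Rightarrow> ((nat \<times> nat) list \<Rightarrow> 'k) set" where
  "frt_gen K N c i j = frt_ideal K N c +>\<^bsub>frt_free K N\<^esub> frt_var K i j"

definition is_frt_comult ::
  "('k, 'c) ring_scheme \<Rightarrow> nat \<Rightarrow> (nat \<Rightarrow> nat \<Rightarrow> nat \<Rightarrow> nat \<Rightarrow> 'k)
    \<Rightarrow> (((nat \<times> nat) list \<Rightarrow> 'k) set
         \<Rightarrow> (((nat \<times> nat) list \<Rightarrow> 'k) set \<times> ((nat \<times> nat) list \<Rightarrow> 'k) set \<Rightarrow> 'k) set) \<Rightarrow> bool" where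
  "is_frt_comult K N c \<Delta> \<longleftrightarrow>
    (let A = frt K N c; T = frt_gen K N c in
     \<Delta> \<in> algebra_hom K A (tensor_algebra K A A) \<and>
     (\<forall>i\<in>{1..N}. \<forall>j\<in>{1..N}.
        \<Delta> (T i j) = (\<Oplus>\<^bsub>tensor K A A\<^esub>k\<in>{1..N}. pure_tensor K A A (T i k) (T k j))))"

text \<open>The counit of the bialgebra \<open>A(\<gamma>)\<close> is the algebra morphism with \<open>\<epsilon>(T_i^j) = \<delta>_{ij}\<close>.\<close>

definition is_frt_counit ::
  "('k, 'c) ring_scheme \<Rightarrow> nat \<Rightarrow> (nat \<Rightarrow> nat \<Rightarrow> nat \<Rightarrow> nat \<Rightarrow> 'k)
    \<Rightarrow> (((nat \<times> nat) list \<Rightarrow> 'k) set \<Rightarrow> 'k) \<Rightarrow> bool" where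
  "is_frt_counit K N c \<epsilon> \<longleftrightarrow>
    \<epsilon> \<in> algebra_hom K (frt K N c) (self_module K) \<and>
    (\<forall>i\<in>{1..N}. \<forall>j\<in>{1..N}. \<epsilon> (frt_gen K N c i j) = (if i = j then \<one>\<^bsub>K\<^esub> else \<zero>\<^bsub>K\<^esub>))"

text \<open>
  Sweedler sums \<open>\<Sum> g(x_1, x_2)\<close> of a bilinear \<open>g\<close> with values in \<open>K\<close> are evaluated as
  \<open>tensor_lift K (self_module K) g (\<Delta> x)\<close>.
\<close>

definition is_frt_form ::
  "('k, 'c) ring_scheme \<Rightarrow> nat \<Rightarrow> (nat \<Rightarrow> nat \<Rightarrow> nat \<Rightarrow> nat \<Rightarrow> 'k)
    \<Rightarrow> (((nat \<times> nat) list \<Rightarrow> 'k) set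
         \<Rightarrow> (((nat \<times> nat) list \<Rightarrow> 'k) set \<times> ((nat \<times> nat) list \<Rightarrow> 'k) set \<Rightarrow> 'k) set)
    \<Rightarrow> ((((nat \<times> nat) list \<Rightarrow> 'k) set \<times> ((nat \<times> nat) list \<Rightarrow> 'k) set \<Rightarrow> 'k) set \<Rightarrow> 'k) \<Rightarrow> bool" where
  "is_frt_form K N c \<Delta> R \<longleftrightarrow>
    (let A = frt K N c; T = frt_gen K N c; t = pure_tensor K A A;
         \<delta> = (\<lambda>i j. if i = j then \<one>\<^bsub>K\<^esub> else \<zero>\<^bsub>K\<^esub>) in
     R \<in> module_hom K (tensor K A A) (self_module K) \<and>
     (\<forall>i\<in>{1..N}. \<forall>j\<in>{1..N}. \<forall>m\<in>{1..N}. \<forall>n\<in>{1..N}. R (t (T i m) (T j n)) = c j i m n) \<and>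
     (\<forall>i\<in>{1..N}. \<forall>j\<in>{1..N}. R (t \<one>\<^bsub>A\<^esub> (T i j)) = \<delta> i j \<and> R (t (T i j) \<one>\<^bsub>A\<^esub>) = \<delta> i j) \<and>
     (\<forall>x\<in>carrier A. \<forall>y\<in>carrier A. \<forall>z\<in>carrier A.
        R (t (x \<otimes>\<^bsub>A\<^esub> y) z) =
          tensor_lift K (self_module K) (\<lambda>z1 z2. R (t x z1) \<otimes>\<^bsub>K\<^esub> R (t y z2)) (\<Delta> z)) \<and>
     (\<forall>x\<in>carrier A. \<forall>y\<in>carrier A. \<forall>z\<in>carrier A.
        R (t x (y \<otimes>\<^bsub>A\<^esub> z)) =
          tensor_lift K (self_module K) (\<lambda>x1 x2. R (t x1 z) \<otimes>\<^bsub>K\<^esub> R (t x2 y)) (\<Delta> x)))"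

definition bialgebra_hom ::
  "('k, 'c) ring_scheme
    \<Rightarrow> ('k, 'a, 'd) module_scheme \<Rightarrow> ('a \<Rightarrow> ('a \<times> 'a \<Rightarrow> 'k) set) \<Rightarrow> ('a \<Rightarrow> 'k)
    \<Rightarrow> ('k, 'b, 'e) module_scheme \<Rightarrow> ('b \<Rightarrow> ('b \<times> 'b \<Rightarrow> 'k) set) \<Rightarrow> ('b \<Rightarrow> 'k)
    \<Rightarrow> ('a \<Rightarrow> 'b) set" where
  "bialgebra_hom K A \<Delta>\<^sub>A \<epsilon>\<^sub>A B \<Delta>\<^sub>B \<epsilon>\<^sub>B =
    {f \<in> algebra_hom K A B.
       \<forall>x\<in>carrier A. \<Delta>\<^sub>B (f x) = tensor_map K B B f f (\<Delta>\<^sub>A x) \<and> \<epsilon>\<^sub>B (f x) = \<epsilon>\<^sub>A x}"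

end

theory Submission
  imports Defs
begin

text \<open>
  Everything rests on one computation. Give \<open>T i j\<close> the weight \<open>l i / l j\<close>. The hypothesis says that
  \<open>c i j m n\<close> can be nonzero only when \<open>l i l j = l m l n\<close>, so all monomials in the defining relation
  with indices \<open>i\<close>, \<open>j\<close>, \<open>m\<close>, \<open>n\<close> have the same weight \<open>(l i l j) / (l m l n)\<close>. The rescaled generators
  therefore satisfy the relations again (\<open>frt_relations_hold_scaled\<close>), and the universal property of
  the FRT algebra (\<open>frt_lift\<close>) yields the endomorphism \<open>\<alpha>\<close>. It is unique because the generators
  generate (\<open>frt_induct\<close>).

  The remaining claims compare maps that are determined by their values on generators. For the
  coalgebra structure this is the identity \<open>(l i / l k) (l k / l j) = l i / l j\<close>, together with the
  multiplicativity of \<open>\<Delta>\<close>, of the counit, and of \<open>\<alpha> \<otimes> \<alpha>\<close> (\<open>comultiplication_scaling\<close>,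
  \<open>counit_scaling\<close>). The form \<open>R\<close> and its twist \<open>R \<circ> (\<alpha> \<otimes> \<alpha>)\<close> satisfy the same product rules, since \<open>\<alpha>\<close>
  respects products and coproducts, and on generators the twist multiplies \<open>c j i m n\<close> by a factor
  that is \<open>1\<close> wherever the coefficient is nonzero (\<open>form_scaling_pure\<close>). The two statements about \<open>V\<close>
  are equalities of linear maps, checked on the basis.

  The tensor products, the free algebra and the FRT algebra are concrete spaces of finitely supported
  functions and quotients of such spaces. The arguments above only see their universal properties
  (\<open>tensor_lift_well_defined\<close>, \<open>free_algebra_lift\<close>, \<open>frt_lift\<close>) and the fact that they are generated by
  pure tensors, words and the \<open>T i j\<close> (\<open>tensor_induct\<close>, \<open>free_module_induct\<close>, \<open>frt_induct\<close>).
\<close>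

section \<open>Linear and bilinear maps\<close>

lemma module_hom_in_carrier:
  "h \<in> module_hom K M N \<Longrightarrow> x \<in> carrier M \<Longrightarrow> h x \<in> carrier N"
  using module_hom_closed by fastforce

lemma module_homI:
  assumes "\<And>x. x \<in> carrier M \<Longrightarrow> h x \<in> carrier N"
    and "\<And>x y. x \<in> carrier M \<Longrightarrow> y \<in> carrier M \<Longrightarrow> h (x \<oplus>\<^bsub>M\<^esub> y) = h x \<oplus>\<^bsub>N\<^esub> h y"
    and "\<And>a x. a \<in> carrier K \<Longrightarrow> x \<in> carrier M \<Longrightarrow> h (a \<odot>\<^bsub>M\<^esub> x) = a \<odot>\<^bsub>N\<^esub> h x"
  shows "h \<in> module_hom K M N"
  using assms by (auto simp: module_hom_def)

lemma module_record_cong: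
  fixes M N :: "('k, 'm, 'd) module_scheme"
  assumes "module K M"
    and "carrier N = carrier M" "add N = add M" "zero N = zero M" "smult N = smult M"
  shows "module K N"
  using assms
  unfolding module_def abelian_group_def abelian_group_axioms_def abelian_monoid_def module_axioms_def
  by simp

lemma module_hom_zero:
  assumes "module K M" "module K N" "h \<in> module_hom K M N"
  shows "h \<zero>\<^bsub>M\<^esub> = \<zero>\<^bsub>N\<^esub>"
proof -
  interpret mod_hom K M N h
    using assms by (simp add: mod_hom_def mod_hom_axioms_def)
  show ?thesis by (rule f0_is_0)
qed

lemma module_hom_finsum:
  assumes M: "module K M" and N: "module K N" and h: "h \<in> module_hom K M N"
    and "f \<in> I \<rightarrow> carrier M"
  shows "h (\<Oplus>\<^bsub>M\<^esub>i\<in>I. f i) = (\<Oplus>\<^bsub>N\<^esub>i\<in>I. h (f i))"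
proof -
  interpret M: module K M by fact
  interpret N: module K N by fact
  show ?thesis
    using assms(4)
  proof (induction I rule: infinite_finite_induct)
    case (insert i I)
    have "(\<lambda>i. h (f i)) \<in> I \<rightarrow> carrier N" "h (f i) \<in> carrier N"
      using insert.prems module_hom_in_carrier[OF h] by auto
    then show ?case
      using insert module_hom_add[OF h] by (simp add: M.M.finsum_insert N.M.finsum_insert)
  qed (simp_all add: module_hom_zero[OF M N h])
qed

lemma module_hom_finsum_eqI:
  assumes M: "module K M" and N: "module K N"
    and g: "g \<in> module_hom K M N" and h: "h \<in> module_hom K M N"
    and f: "\<And>i. i \<in> I \<Longrightarrow> f i \<in> carrier M" and eq: "\<And>i. i \<in> I \<Longrightarrow> g (f i) = h (f i)"
  shows "g (\<Oplus>\<^bsub>M\<^esub>i\<in>I. f i) = h (\<Oplus>\<^bsub>M\<^esub>i\<in>I. f i)"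
proof -
  interpret N: module K N by fact
  have "(\<Oplus>\<^bsub>N\<^esub>i\<in>I. g (f i)) = (\<Oplus>\<^bsub>N\<^esub>i\<in>I. h (f i))"
    using module_hom_in_carrier[OF h f] eq by (intro N.M.finsum_cong') auto
  then show ?thesis
    using f by (simp add: module_hom_finsum[OF M N g] module_hom_finsum[OF M N h])
qed

text \<open>The vectors on which two linear maps agree form a submodule, so it contains the span of \<open>B\<close>.\<close>

lemma gen_set_hom_eqI:
  assumes M: "module K M" and N: "module K N"
    and g: "g \<in> module_hom K M N" and h: "h \<in> module_hom K M N"
    and gen: "module.span K M B = carrier M"
    and eq: "\<And>x. x \<in> B \<Longrightarrow> g x = h x" and B: "B \<subseteq> carrier M"
    and x: "x \<in> carrier M"
  shows "g x = h x"
proof -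
  interpret M: module K M by fact
  have "submodule K {x \<in> carrier M. g x = h x} M"
    by (rule submodule.intro[OF M])
      (auto simp: module_hom_add[OF g] module_hom_add[OF h] module_hom_smult[OF g]
        module_hom_smult[OF h] module_hom_zero[OF M N g] module_hom_zero[OF M N h])
  then have "M.span B \<subseteq> {x \<in> carrier M. g x = h x}"
    using eq B by (intro M.span_is_subset) auto
  then show ?thesis
    using gen x by auto
qed

lemma module_hom_comp:
  assumes "g \<in> module_hom K L M" "h \<in> module_hom K M N"
  shows "(\<lambda>x. h (g x)) \<in> module_hom K L N"
  using assms by (auto simp: module_hom_def Pi_def)

lemma module_hom_cong:
  assumes M: "module K M" and h: "h \<in> module_hom K M N"
    and eq: "\<And>x. x \<in> carrier M \<Longrightarrow> h' x = h x"
  shows "h' \<in> module_hom K M N"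
proof -
  interpret M: module K M by fact
  show ?thesis
    by (rule module_homI)
      (simp_all add: eq module_hom_in_carrier[OF h] module_hom_add[OF h] module_hom_smult[OF h])
qed

lemma module_hom_sum:
  assumes N: "module K N" and g: "g \<in> module_hom K M N" and h: "h \<in> module_hom K M N"
  shows "(\<lambda>x. g x \<oplus>\<^bsub>N\<^esub> h x) \<in> module_hom K M N"
proof -
  interpret N: module K N by fact
  note gh = g h
  show ?thesis
    by (rule module_homI)
      (simp_all add: gh[THEN module_hom_in_carrier] gh[THEN module_hom_add]
        gh[THEN module_hom_smult] N.smult_r_distr N.M.a_ac)
qed

definition bilinear_map ::
  "('k, 'c) ring_scheme \<Rightarrow> ('k, 'u, 'd) module_scheme \<Rightarrow> ('k, 'w, 'e) module_scheme
    \<Rightarrow> ('k, 'm, 'f) module_scheme \<Rightarrow> ('u \<Rightarrow> 'w \<Rightarrow> 'm) \<Rightarrow> bool" where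
  "bilinear_map K U W M b \<longleftrightarrow>
    (\<forall>u\<in>carrier U. b u \<in> module_hom K W M) \<and> (\<forall>w\<in>carrier W. (\<lambda>u. b u w) \<in> module_hom K U M)"

lemma bilinear_mapI:
  assumes "\<And>u. u \<in> carrier U \<Longrightarrow> b u \<in> module_hom K W M"
    and "\<And>w. w \<in> carrier W \<Longrightarrow> (\<lambda>u. b u w) \<in> module_hom K U M"
  shows "bilinear_map K U W M b"
  using assms by (simp add: bilinear_map_def)

lemma bilinear_mapD:
  assumes "bilinear_map K U W M b"
  shows "u \<in> carrier U \<Longrightarrow> b u \<in> module_hom K W M"
    and "w \<in> carrier W \<Longrightarrow> (\<lambda>u. b u w) \<in> module_hom K U M"
  using assms by (simp_all add: bilinear_map_def)

lemma bilinear_map_cong: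
  assumes U: "module K U" and W: "module K W" and b: "bilinear_map K U W M b"
    and eq: "\<And>u w. u \<in> carrier U \<Longrightarrow> w \<in> carrier W \<Longrightarrow> b' u w = b u w"
  shows "bilinear_map K U W M b'"
  by (intro bilinear_mapI module_hom_cong[OF W bilinear_mapD(1)[OF b]]
      module_hom_cong[OF U bilinear_mapD(2)[OF b]]) (auto simp: eq)

lemma bilinear_map_add:
  assumes M: "module K M" and b: "bilinear_map K U W M b" and b': "bilinear_map K U W M b'"
  shows "bilinear_map K U W M (\<lambda>u w. b u w \<oplus>\<^bsub>M\<^esub> b' u w)"
  by (intro bilinear_mapI module_hom_sum[OF M] bilinear_mapD(1)[OF b] bilinear_mapD(1)[OF b']
      bilinear_mapD(2)[OF b] bilinear_mapD(2)[OF b'])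

lemma bilinear_map_comp:
  assumes "bilinear_map K U W M b" "f \<in> module_hom K U' U" "g \<in> module_hom K W' W"
  shows "bilinear_map K U' W' M (\<lambda>u w. b (f u) (g w))"
proof (rule bilinear_mapI)
  show "(\<lambda>w. b (f u) (g w)) \<in> module_hom K W' M" if "u \<in> carrier U'" for u
    using module_hom_comp[OF assms(3) bilinear_mapD(1)[OF assms(1)]]
      module_hom_in_carrier[OF assms(2) that] .
  show "(\<lambda>u. b (f u) (g w)) \<in> module_hom K U' M" if "w \<in> carrier W'" for w
    using module_hom_comp[OF assms(2) bilinear_mapD(2)[OF assms(1)]]
      module_hom_in_carrier[OF assms(3) that] .
qed

lemma module_hom_comp_bilinear:
  assumes "bilinear_map K U W M b" "h \<in> module_hom K M N"
  shows "bilinear_map K U W N (\<lambda>u w. h (b u w))"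
  using module_hom_comp[OF bilinear_mapD(1)[OF assms(1)] assms(2)]
    module_hom_comp[OF bilinear_mapD(2)[OF assms(1)] assms(2)]
  by (rule bilinear_mapI)

lemma self_module_simps [simp]:
  "carrier (self_module K) = carrier K" "mult (self_module K) = mult K"
  "one (self_module K) = one K" "zero (self_module K) = zero K"
  "add (self_module K) = add K" "smult (self_module K) = mult K"
  by (simp_all add: self_module_def)

lemma self_module_is_module:
  assumes "cring K"
  shows "module K (self_module K)"
proof -
  interpret cring K by fact
  have "abelian_group (self_module K)"
    by (rule abelian_groupI) (auto intro: a_assoc a_comm l_neg)
  then show ?thesis
    by (intro moduleI) (auto simp: assms l_distr r_distr m_assoc)
qed

lemma bilinear_map_mult:
  assumes K: "cring K" and f: "f \<in> module_hom K U (self_module K)"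
    and g: "g \<in> module_hom K W (self_module K)"
  shows "bilinear_map K U W (self_module K) (\<lambda>u w. f u \<otimes>\<^bsub>K\<^esub> g w)"
proof -
  interpret cring K by fact
  show ?thesis
    using module_hom_in_carrier[OF f] module_hom_in_carrier[OF g]
    by (intro bilinear_mapI module_homI)
      (auto simp: l_distr r_distr m_ac module_hom_add[OF f] module_hom_add[OF g]
         module_hom_smult[OF f] module_hom_smult[OF g])
qed

section \<open>Free modules\<close>

lemma free_module_simps [simp]:
  "zero (free_module K S) = (\<lambda>p. \<zero>\<^bsub>K\<^esub>)"
  "add (free_module K S) = (\<lambda>f g p. f p \<oplus>\<^bsub>K\<^esub> g p)"
  "smult (free_module K S) = (\<lambda>a f p. a \<otimes>\<^bsub>K\<^esub> f p)"
  by (simp_all add: free_module_def)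

lemma free_module_carrier:
  "f \<in> carrier (free_module K S) \<longleftrightarrow>
    (\<forall>p\<in>S. f p \<in> carrier K) \<and> (\<forall>p. p \<notin> S \<longrightarrow> f p = \<zero>\<^bsub>K\<^esub>) \<and> finite {p. f p \<noteq> \<zero>\<^bsub>K\<^esub>}"
  by (auto simp: free_module_def)

lemma free_module_coeff:
  "cring K \<Longrightarrow> f \<in> carrier (free_module K S) \<Longrightarrow> f p \<in> carrier K"
  by (metis free_module_carrier cring.cring_simprules(2))

lemma free_module_add_closed:
  assumes "cring K" "f \<in> carrier (free_module K S)" "g \<in> carrier (free_module K S)"
  shows "(\<lambda>p. f p \<oplus>\<^bsub>K\<^esub> g p) \<in> carrier (free_module K S)"
proof -
  interpret cring K by fact
  have "{p. f p \<oplus>\<^bsub>K\<^esub> g p \<noteq> \<zero>\<^bsub>K\<^esub>} \<subseteq> {p. f p \<noteq> \<zero>\<^bsub>K\<^esub>} \<union> {p. g p \<noteq> \<zero>\<^bsub>K\<^esub>}"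
    by auto
  then show ?thesis
    using assms by (auto simp: free_module_carrier intro: finite_subset)
qed

lemma free_module_diagonal_closed:
  assumes "cring K" "f \<in> carrier (free_module K S)" "\<And>p. a p \<in> carrier K"
  shows "(\<lambda>p. a p \<otimes>\<^bsub>K\<^esub> f p) \<in> carrier (free_module K S)"
proof -
  interpret cring K by fact
  have "{p. a p \<otimes>\<^bsub>K\<^esub> f p \<noteq> \<zero>\<^bsub>K\<^esub>} \<subseteq> {p. f p \<noteq> \<zero>\<^bsub>K\<^esub>}"
    using assms(3) by auto
  then show ?thesis
    using assms by (auto simp: free_module_carrier intro: finite_subset)
qed

lemma free_module_is_module:
  assumes "cring K"
  shows "module K (free_module K S)"
proof -
  interpret cring K by fact
  note [simp] = free_module_coeff[OF assms] free_module_add_closed[OF assms]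
  have neg: "(\<lambda>p. \<ominus>\<^bsub>K\<^esub> \<one>\<^bsub>K\<^esub> \<otimes>\<^bsub>K\<^esub> f p) \<in> carrier (free_module K S)" if "f \<in> carrier (free_module K S)" for f
    using that by (intro free_module_diagonal_closed[OF assms]) auto
  have zero: "(\<lambda>p. \<zero>\<^bsub>K\<^esub>) \<in> carrier (free_module K S)"
    by (simp add: free_module_carrier)
  have "abelian_group (free_module K S)"
  proof (rule abelian_groupI, goal_cases)
    case (6 f)
    then show ?case
      by (intro bexI[OF _ neg]) (auto simp: l_minus l_neg)
  qed (auto simp: zero a_ac)
  then show ?thesis
    by (intro moduleI)
      (auto simp: assms l_distr r_distr m_assoc intro!: free_module_diagonal_closed)
qed

lemma unit_vec_at_closed:
  assumes "cring K" "p \<in> S"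
  shows "unit_vec_at K p \<in> carrier (free_module K S)"
proof -
  interpret cring K by fact
  have "{q. unit_vec_at K p q \<noteq> \<zero>\<^bsub>K\<^esub>} \<subseteq> {p}"
    by (auto simp: unit_vec_at_def)
  then show ?thesis
    using assms(2) by (auto simp: free_module_carrier unit_vec_at_def intro: finite_subset)
qed

text \<open>
  Induction on the support: resetting one coefficient to zero splits off a multiple of a basis
  vector.
\<close>

lemma free_module_induct [consumes 2, case_names zero unit add smult]:
  assumes K: "cring K" and f: "f \<in> carrier (free_module K S)"
    and zero: "P (\<lambda>p. \<zero>\<^bsub>K\<^esub>)"
    and unit: "\<And>p. p \<in> S \<Longrightarrow> P (unit_vec_at K p)"
    and add: "\<And>f g. \<lbrakk>f \<in> carrier (free_module K S); g \<in> carrier (free_module K S); P f; P g\<rbrakk>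
      \<Longrightarrow> P (\<lambda>p. f p \<oplus>\<^bsub>K\<^esub> g p)"
    and smult: "\<And>a f. \<lbrakk>a \<in> carrier K; f \<in> carrier (free_module K S); P f\<rbrakk> \<Longrightarrow> P (\<lambda>p. a \<otimes>\<^bsub>K\<^esub> f p)"
  shows "P f"
proof -
  interpret cring K by fact
  have "finite {p. f p \<noteq> \<zero>\<^bsub>K\<^esub>}"
    using f by (simp add: free_module_carrier)
  then show ?thesis
    using f
  proof (induction "{p. f p \<noteq> \<zero>\<^bsub>K\<^esub>}" arbitrary: f rule: finite_induct)
    case empty
    then have "f = (\<lambda>p. \<zero>\<^bsub>K\<^esub>)"
      by auto
    then show ?case
      using zero by simp
  next
    case (insert q B f)
    have q: "q \<in> S"
      using insert.hyps(4) insert.prems by (auto simp: free_module_carrier)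
    let ?g = "f(q := \<zero>\<^bsub>K\<^esub>)"
    let ?h = "\<lambda>p. f q \<otimes>\<^bsub>K\<^esub> unit_vec_at K q p"
    have B: "B = {p. ?g p \<noteq> \<zero>\<^bsub>K\<^esub>}"
      using insert.hyps(2,4) by auto
    then have g: "?g \<in> carrier (free_module K S)"
      using insert.prems insert.hyps(1) by (auto simp: free_module_carrier)
    have fq: "f q \<in> carrier K"
      using insert.prems by (rule free_module_coeff[OF K])
    have h: "?h \<in> carrier (free_module K S)"
      using fq unit_vec_at_closed[OF K q] by (intro free_module_diagonal_closed[OF K]) auto
    have "f = (\<lambda>p. ?g p \<oplus>\<^bsub>K\<^esub> ?h p)"
      using free_module_coeff[OF K insert.prems] by (auto simp: unit_vec_at_def)
    moreover have "P (\<lambda>p. ?g p \<oplus>\<^bsub>K\<^esub> ?h p)"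
      by (rule add[OF g h insert.hyps(3)[OF B g] smult[OF fq unit_vec_at_closed[OF K q] unit[OF q]]])
    ultimately show ?case
      by simp
  qed
qed

text \<open>
  The summation range in the definition of \<open>linear_extension\<close> depends on the vector, so sums over
  different vectors can only be compared on a common finite range.
\<close>

lemma linear_extension_superset:
  assumes M: "module K M" and b: "\<And>p. p \<in> S \<Longrightarrow> b p \<in> carrier M"
    and f: "f \<in> carrier (free_module K S)"
    and "finite B" "B \<subseteq> S" "{p. f p \<noteq> \<zero>\<^bsub>K\<^esub>} \<subseteq> B"
  shows "linear_extension K M b f = (\<Oplus>\<^bsub>M\<^esub>p\<in>B. f p \<odot>\<^bsub>M\<^esub> b p)"
proof -
  interpret M: module K M by fact
  have "f p \<odot>\<^bsub>M\<^esub> b p \<in> carrier M" if "p \<in> B" for p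
    using that assms free_module_coeff[OF M.is_cring f] by blast
  then show ?thesis
    unfolding linear_extension_def
    using assms b by (intro M.M.add.finprod_mono_neutral_cong_left) (auto simp: subset_iff)
qed

lemma linear_extension_hom:
  assumes M: "module K M" and b: "\<And>p. p \<in> S \<Longrightarrow> b p \<in> carrier M"
  shows "linear_extension K M b \<in> module_hom K (free_module K S) M"
proof (rule module_homI)
  interpret M: module K M by fact
  let ?F = "free_module K S"
  let ?supp = "\<lambda>f. {p. f p \<noteq> \<zero>\<^bsub>K\<^esub>}"
  note K = M.is_cring
  have supp: "finite (?supp f)" "?supp f \<subseteq> S" if "f \<in> carrier ?F" for f
    using that by (auto simp: free_module_carrier)
  have sc: "f p \<odot>\<^bsub>M\<^esub> b p \<in> carrier M" if "f \<in> carrier ?F" "p \<in> S" for f p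
    using that by (intro M.smult_closed free_module_coeff[OF K] b)
  show "linear_extension K M b f \<in> carrier M" if "f \<in> carrier ?F" for f
    unfolding linear_extension_def
    using sc[OF that] supp(2)[OF that] by (intro M.M.finsum_closed) auto
  show "linear_extension K M b (f \<oplus>\<^bsub>?F\<^esub> g) = linear_extension K M b f \<oplus>\<^bsub>M\<^esub> linear_extension K M b g"
    if f: "f \<in> carrier ?F" and g: "g \<in> carrier ?F" for f g
  proof -
    let ?B = "?supp f \<union> ?supp g"
    have B: "finite ?B" "?B \<subseteq> S"
      using supp f g by auto
    have fg: "f \<oplus>\<^bsub>?F\<^esub> g \<in> carrier ?F"
      using free_module_add_closed[OF K f g] by simp
    have eq: "linear_extension K M b h = (\<Oplus>\<^bsub>M\<^esub>p\<in>?B. h p \<odot>\<^bsub>M\<^esub> b p)"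
      if "h \<in> carrier ?F" "?supp h \<subseteq> ?B" for h
      by (rule linear_extension_superset[OF M b that(1) B that(2)])
    have "linear_extension K M b (f \<oplus>\<^bsub>?F\<^esub> g) = (\<Oplus>\<^bsub>M\<^esub>p\<in>?B. (f \<oplus>\<^bsub>?F\<^esub> g) p \<odot>\<^bsub>M\<^esub> b p)"
      by (rule eq[OF fg]) auto
    also have "\<dots> = (\<Oplus>\<^bsub>M\<^esub>p\<in>?B. f p \<odot>\<^bsub>M\<^esub> b p \<oplus>\<^bsub>M\<^esub> g p \<odot>\<^bsub>M\<^esub> b p)"
      using B(2) sc f g free_module_coeff[OF K] b
      by (intro M.M.finsum_cong') (auto simp: subset_iff intro!: M.smult_l_distr)
    also have "\<dots> = (\<Oplus>\<^bsub>M\<^esub>p\<in>?B. f p \<odot>\<^bsub>M\<^esub> b p) \<oplus>\<^bsub>M\<^esub> (\<Oplus>\<^bsub>M\<^esub>p\<in>?B. g p \<odot>\<^bsub>M\<^esub> b p)"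
      using B(2) sc f g by (intro M.M.finsum_addf) blast+
    also have "\<dots> = linear_extension K M b f \<oplus>\<^bsub>M\<^esub> linear_extension K M b g"
      using eq[OF f] eq[OF g] by auto
    finally show ?thesis .
  qed
  show "linear_extension K M b (a \<odot>\<^bsub>?F\<^esub> f) = a \<odot>\<^bsub>M\<^esub> linear_extension K M b f"
    if a: "a \<in> carrier K" and f: "f \<in> carrier ?F" for a f
  proof -
    have af: "a \<odot>\<^bsub>?F\<^esub> f \<in> carrier ?F"
      using module.smult_closed[OF free_module_is_module[OF K] a f] .
    have "linear_extension K M b (a \<odot>\<^bsub>?F\<^esub> f) = (\<Oplus>\<^bsub>M\<^esub>p\<in>?supp f. (a \<odot>\<^bsub>?F\<^esub> f) p \<odot>\<^bsub>M\<^esub> b p)"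
      using a by (intro linear_extension_superset[OF M b af supp[OF f]]) auto
    also have "\<dots> = (\<Oplus>\<^bsub>M\<^esub>p\<in>?supp f. a \<odot>\<^bsub>M\<^esub> (f p \<odot>\<^bsub>M\<^esub> b p))"
      using supp(2)[OF f] sc[OF f] a free_module_coeff[OF K f] b
      by (intro M.M.finsum_cong') (auto simp: subset_iff intro!: M.smult_assoc1)
    also have "\<dots> = a \<odot>\<^bsub>M\<^esub> linear_extension K M b f"
      unfolding linear_extension_def
      using supp(2)[OF f] sc[OF f] a by (intro M.finsum_smult[symmetric]) auto
    finally show ?thesis .
  qed
qed

lemma linear_extension_unit:
  assumes M: "module K M" and b: "\<And>p. p \<in> S \<Longrightarrow> b p \<in> carrier M" and p: "p \<in> S"
  shows "linear_extension K M b (unit_vec_at K p) = b p"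
proof -
  interpret M: module K M by fact
  have "linear_extension K M b (unit_vec_at K p) = (\<Oplus>\<^bsub>M\<^esub>q\<in>{p}. unit_vec_at K p q \<odot>\<^bsub>M\<^esub> b q)"
    using p unit_vec_at_closed[OF M.is_cring p]
    by (intro linear_extension_superset[OF M b]) (auto simp: unit_vec_at_def)
  then show ?thesis
    using b[OF p] by (simp add: unit_vec_at_def)
qed

section \<open>Quotient modules\<close>

locale quotient_module =
  fixes K :: "('k, 'c) ring_scheme" and M :: "('k, 'm, 'd) module_scheme" and H :: "'m set"
  assumes module: "module K M" and submodule: "submodule K H M"
begin

sublocale M: module K M
  by (rule module)

sublocale H: abelian_subgroup H M
proof (rule abelian_subgroupI3)
  interpret H: submodule K H M by (rule submodule)
  have "\<ominus>\<^bsub>M\<^esub> x \<in> H" if "x \<in> H" for x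
    using M.smult_minus_1[of x, symmetric] that H.subset by (auto intro!: H.smult_closed)
  then show "additive_subgroup H M"
    unfolding additive_subgroup_def using H.subset H.m_closed H.zero_closed
    by (intro M.add.subgroupI) (auto simp: a_inv_def simp del: H.zero_closed)
qed (rule M.abelian_group_axioms)

abbreviation coset :: "'m \<Rightarrow> 'm set" where
  "coset x \<equiv> H +>\<^bsub>M\<^esub> x"

lemma smult_mem: "a \<in> carrier K \<Longrightarrow> x \<in> H \<Longrightarrow> a \<odot>\<^bsub>M\<^esub> x \<in> H"
  by (rule submodule.smult_closed[OF submodule])

lemma coset_eq_iff:
  assumes "x \<in> carrier M" "y \<in> carrier M"
  shows "coset x = coset y \<longleftrightarrow> x \<ominus>\<^bsub>M\<^esub> y \<in> H"
proof -
  have "coset x = coset y \<longleftrightarrow> x \<in> coset y"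
    using assms H.a_rcos_self[of x] H.a_repr_independence'[of x y] by auto
  then show ?thesis
    using assms H.a_rcos_module[of y x] by (simp add: a_minus_def)
qed

lemma carrier_quot: "carrier (quot_module M H) = coset ` carrier M"
  by (auto simp: quot_module_def FactRing_simps)

lemma add_quot:
  "x \<in> carrier M \<Longrightarrow> y \<in> carrier M \<Longrightarrow> coset x \<oplus>\<^bsub>quot_module M H\<^esub> coset y = coset (x \<oplus>\<^bsub>M\<^esub> y)"
  by (simp add: quot_module_def FactRing_def H.a_rcos_sum)

lemma zero_quot: "\<zero>\<^bsub>quot_module M H\<^esub> = coset \<zero>\<^bsub>M\<^esub>"
  by (simp add: quot_module_def FactRing_def H.a_subset)

lemma in_coset: "y \<in> coset x \<Longrightarrow> x \<in> carrier M \<Longrightarrow> y \<in> carrier M \<and> y \<ominus>\<^bsub>M\<^esub> x \<in> H"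
  using H.a_elemrcos_carrier[of x y] H.a_rcos_module[of x y] by (simp add: a_minus_def)

text \<open>
  The scalar multiple of a coset is a union over its representatives; as \<open>H\<close> is closed under
  scalars, all the cosets in this union coincide.
\<close>

lemma smult_quot:
  assumes a: "a \<in> carrier K" and x: "x \<in> carrier M"
  shows "a \<odot>\<^bsub>quot_module M H\<^esub> coset x = coset (a \<odot>\<^bsub>M\<^esub> x)"
proof -
  have "coset (a \<odot>\<^bsub>M\<^esub> y) = coset (a \<odot>\<^bsub>M\<^esub> x)" if "y \<in> coset x" for y
  proof -
    have y: "y \<in> carrier M" "y \<ominus>\<^bsub>M\<^esub> x \<in> H"
      using in_coset[OF that x] by auto
    have "a \<odot>\<^bsub>M\<^esub> y \<ominus>\<^bsub>M\<^esub> a \<odot>\<^bsub>M\<^esub> x = a \<odot>\<^bsub>M\<^esub> (y \<ominus>\<^bsub>M\<^esub> x)"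
      using a x y(1) by (simp add: a_minus_def M.smult_r_distr M.smult_r_minus)
    then show ?thesis
      using smult_mem[OF a y(2)] a x y(1) by (simp add: coset_eq_iff)
  qed
  then have "(\<Union>y\<in>coset x. coset (a \<odot>\<^bsub>M\<^esub> y)) = (\<Union>y\<in>coset x. coset (a \<odot>\<^bsub>M\<^esub> x))"
    by (rule SUP_cong[OF refl])
  also have "\<dots> = coset (a \<odot>\<^bsub>M\<^esub> x)"
    using H.a_rcos_self[OF x] by (metis UN_constant empty_iff)
  finally show ?thesis
    by (simp add: quot_module_def)
qed

lemma quot_module_is_module: "module K (quot_module M H)"
proof -
  let ?Q = "quot_module M H"
  have "abelian_group ?Q"
  proof (rule abelian_groupI)
    show "\<exists>Y\<in>carrier ?Q. Y \<oplus>\<^bsub>?Q\<^esub> X = \<zero>\<^bsub>?Q\<^esub>" if X: "X \<in> carrier ?Q" for X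
    proof -
      obtain x where "x \<in> carrier M" "X = coset x"
        using X by (auto simp: carrier_quot)
      then show ?thesis
        by (intro bexI[of _ "coset (\<ominus>\<^bsub>M\<^esub> x)"]) (auto simp: carrier_quot add_quot zero_quot M.M.l_neg)
    qed
  qed (auto simp: carrier_quot add_quot zero_quot M.M.a_ac)
  then show ?thesis
    by (intro moduleI)
      (auto simp: M.is_cring carrier_quot add_quot smult_quot M.smult_l_distr M.smult_r_distr
        M.smult_assoc1)
qed

lemma coset_hom: "coset \<in> module_hom K M (quot_module M H)"
  by (rule module_homI) (simp_all add: carrier_quot add_quot smult_quot)

text \<open>
  Two representatives of a coset differ by an element of \<open>H\<close>, on which \<open>h\<close> vanishes; so the image of
  the coset is a singleton.
\<close>

lemma the_elem_image_coset:
  assumes N: "module K N" and h: "h \<in> module_hom K M N"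
    and ker: "\<And>x. x \<in> H \<Longrightarrow> h x = \<zero>\<^bsub>N\<^esub>" and x: "x \<in> carrier M"
  shows "the_elem (h ` coset x) = h x"
proof -
  interpret h: mod_hom K M N h
    using module N h by (simp add: mod_hom_def mod_hom_axioms_def)
  have "h y = h x" if "y \<in> coset x" for y
  proof -
    have y: "y \<in> carrier M" "y \<ominus>\<^bsub>M\<^esub> x \<in> H"
      using in_coset[OF that x] by auto
    have "h y \<ominus>\<^bsub>N\<^esub> h x = h (y \<ominus>\<^bsub>M\<^esub> x)"
      by (rule h.f_minus[OF y(1) x, symmetric])
    also have "\<dots> = \<zero>\<^bsub>N\<^esub>"
      by (rule ker[OF y(2)])
    finally show ?thesis
      by (metis abelian_group.minus_other_side N module_def h.f_im x y(1))
  qed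
  then have "h ` coset x = {h x}"
    using H.a_rcos_self[OF x] by blast
  then show ?thesis
    by simp
qed

lemma quot_hom:
  assumes N: "module K N" and h: "h \<in> module_hom K M N"
    and ker: "\<And>x. x \<in> H \<Longrightarrow> h x = \<zero>\<^bsub>N\<^esub>"
  shows "(\<lambda>X. the_elem (h ` X)) \<in> module_hom K (quot_module M H) N"
proof -
  note eq = the_elem_image_coset[OF assms]
  show ?thesis
    by (rule module_homI)
      (auto simp: carrier_quot add_quot smult_quot eq module_hom_in_carrier[OF h]
        module_hom_add[OF h] module_hom_smult[OF h])
qed

end

section \<open>Tensor products\<close>

lemma bilinear_relators_closed:
  assumes U: "module K U" and W: "module K W"
  shows "bilinear_relators K U W \<subseteq> carrier (free_module K (carrier U \<times> carrier W))"
proof -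
  interpret U: module K U by fact
  interpret W: module K W by fact
  interpret F: module K "free_module K (carrier U \<times> carrier W)"
    by (rule free_module_is_module[OF U.is_cring])
  have e: "unit_vec_at K (u, w) \<in> carrier (free_module K (carrier U \<times> carrier W))"
    if "u \<in> carrier U" "w \<in> carrier W" for u w
    using that by (intro unit_vec_at_closed[OF U.is_cring]) auto
  show ?thesis
    unfolding bilinear_relators_def Let_def
    by (auto simp del: free_module_simps
        intro!: F.M.minus_closed F.M.add.m_closed F.smult_closed e U.smult_closed W.smult_closed)
qed

lemma tensor_quotient_module:
  assumes U: "module K U" and W: "module K W"
  shows "quotient_module K (free_module K (carrier U \<times> carrier W)) (tensor_kernel K U W)"
proof -
  interpret F: module K "free_module K (carrier U \<times> carrier W)"
    by (rule free_module_is_module) (rule module.axioms(1)[OF U])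
  show ?thesis
    unfolding tensor_kernel_def
    by (intro quotient_module.intro F.module_axioms F.span_is_submodule
        bilinear_relators_closed[OF U W])
qed

lemma tensor_is_module:
  assumes "module K U" "module K W"
  shows "module K (tensor K U W)"
  unfolding tensor_def
  by (rule quotient_module.quot_module_is_module[OF tensor_quotient_module[OF assms]])

lemma pure_tensor_closed:
  assumes U: "module K U" and W: "module K W" and "u \<in> carrier U" "w \<in> carrier W"
  shows "pure_tensor K U W u w \<in> carrier (tensor K U W)"
proof -
  interpret Q: quotient_module K "free_module K (carrier U \<times> carrier W)" "tensor_kernel K U W"
    by (rule tensor_quotient_module[OF U W])
  show ?thesis
    unfolding pure_tensor_def tensor_def using assms(3,4)
    by (auto simp: Q.carrier_quot intro!: imageI unit_vec_at_closed Q.M.is_cring)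
qed

lemma bilinear_pure_tensor:
  assumes U: "module K U" and W: "module K W"
  shows "bilinear_map K U W (tensor K U W) (pure_tensor K U W)"
proof -
  interpret U: module K U by fact
  interpret W: module K W by fact
  let ?F = "free_module K (carrier U \<times> carrier W)" and ?e = "unit_vec_at K"
  let ?t = "pure_tensor K U W" and ?T = "tensor K U W"
  interpret Q: quotient_module K ?F "tensor_kernel K U W"
    by (rule tensor_quotient_module[OF U W])
  note [simp del] = free_module_simps
  have e [simp]: "?e (u, w) \<in> carrier ?F" if "u \<in> carrier U" "w \<in> carrier W" for u w
    using that by (intro unit_vec_at_closed[OF U.is_cring]) auto
  have "bilinear_relators K U W \<subseteq> tensor_kernel K U W"
    unfolding tensor_kernel_def by (rule Q.M.in_own_span[OF bilinear_relators_closed[OF U W]])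
  then have rel: "Q.coset x = Q.coset y"
    if "x \<ominus>\<^bsub>?F\<^esub> y \<in> bilinear_relators K U W" "x \<in> carrier ?F" "y \<in> carrier ?F" for x y
    using that by (auto simp: Q.coset_eq_iff)
  note rels = bilinear_relators_def Let_def
  have "?t (u \<oplus>\<^bsub>U\<^esub> u') w = ?t u w \<oplus>\<^bsub>?T\<^esub> ?t u' w"
    if "u \<in> carrier U" "u' \<in> carrier U" "w \<in> carrier W" for u u' w
  proof -
    have "Q.coset (?e (u \<oplus>\<^bsub>U\<^esub> u', w)) = Q.coset (?e (u, w) \<oplus>\<^bsub>?F\<^esub> ?e (u', w))"
      by (rule rel, unfold rels) (use that in \<open>blast, simp_all\<close>)
    then show ?thesis
      unfolding pure_tensor_def tensor_def using that by (simp add: Q.add_quot)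
  qed
  moreover have "?t u (w \<oplus>\<^bsub>W\<^esub> w') = ?t u w \<oplus>\<^bsub>?T\<^esub> ?t u w'"
    if "u \<in> carrier U" "w \<in> carrier W" "w' \<in> carrier W" for u w w'
  proof -
    have "Q.coset (?e (u, w \<oplus>\<^bsub>W\<^esub> w')) = Q.coset (?e (u, w) \<oplus>\<^bsub>?F\<^esub> ?e (u, w'))"
      by (rule rel, unfold rels) (use that in \<open>blast, simp_all\<close>)
    then show ?thesis
      unfolding pure_tensor_def tensor_def using that by (simp add: Q.add_quot)
  qed
  moreover have "?t (a \<odot>\<^bsub>U\<^esub> u) w = a \<odot>\<^bsub>?T\<^esub> ?t u w"
    if "a \<in> carrier K" "u \<in> carrier U" "w \<in> carrier W" for a u w
  proof -
    have "Q.coset (?e (a \<odot>\<^bsub>U\<^esub> u, w)) = Q.coset (a \<odot>\<^bsub>?F\<^esub> ?e (u, w))"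
      by (rule rel, unfold rels) (use that in \<open>blast, simp_all\<close>)
    then show ?thesis
      unfolding pure_tensor_def tensor_def using that by (simp add: Q.smult_quot)
  qed
  moreover have "?t u (a \<odot>\<^bsub>W\<^esub> w) = a \<odot>\<^bsub>?T\<^esub> ?t u w"
    if "a \<in> carrier K" "u \<in> carrier U" "w \<in> carrier W" for a u w
  proof -
    have "Q.coset (?e (u, a \<odot>\<^bsub>W\<^esub> w)) = Q.coset (a \<odot>\<^bsub>?F\<^esub> ?e (u, w))"
      by (rule rel, unfold rels) (use that in \<open>blast, simp_all\<close>)
    then show ?thesis
      unfolding pure_tensor_def tensor_def using that by (simp add: Q.smult_quot)
  qed
  ultimately show ?thesis
    by (intro bilinear_mapI module_homI) (simp_all add: pure_tensor_closed[OF U W])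
qed

lemma pure_tensor_hom:
  assumes "module K U" "module K W"
  shows "u \<in> carrier U \<Longrightarrow> pure_tensor K U W u \<in> module_hom K W (tensor K U W)"
    and "w \<in> carrier W \<Longrightarrow> (\<lambda>u. pure_tensor K U W u w) \<in> module_hom K U (tensor K U W)"
  using bilinear_mapD[OF bilinear_pure_tensor[OF assms]] by blast+

lemma pure_tensor_smult:
  assumes "module K U" "module K W" "a \<in> carrier K" "u \<in> carrier U" "w \<in> carrier W"
  shows "pure_tensor K U W (a \<odot>\<^bsub>U\<^esub> u) w = a \<odot>\<^bsub>tensor K U W\<^esub> pure_tensor K U W u w"
    and "pure_tensor K U W u (a \<odot>\<^bsub>W\<^esub> w) = a \<odot>\<^bsub>tensor K U W\<^esub> pure_tensor K U W u w"
  using module_hom_smult[OF pure_tensor_hom(2)[OF assms(1,2,5)] assms(3,4)]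
    module_hom_smult[OF pure_tensor_hom(1)[OF assms(1,2,4)] assms(3,5)] by auto

lemma pure_tensor_smult_smult:
  assumes U: "module K U" and W: "module K W" and a: "a \<in> carrier K" "b \<in> carrier K"
    and u: "u \<in> carrier U" and w: "w \<in> carrier W"
  shows "pure_tensor K U W (a \<odot>\<^bsub>U\<^esub> u) (b \<odot>\<^bsub>W\<^esub> w) =
    (a \<otimes>\<^bsub>K\<^esub> b) \<odot>\<^bsub>tensor K U W\<^esub> pure_tensor K U W u w"
proof -
  interpret W: module K W by fact
  interpret T: module K "tensor K U W" by (rule tensor_is_module[OF U W])
  show ?thesis
    using a u w pure_tensor_smult[OF U W] pure_tensor_closed[OF U W] by (simp add: T.smult_assoc1)
qed

lemma tensor_induct [consumes 3, case_names pure add]: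
  assumes U: "module K U" and W: "module K W" and t: "t \<in> carrier (tensor K U W)"
    and pure: "\<And>u w. \<lbrakk>u \<in> carrier U; w \<in> carrier W\<rbrakk> \<Longrightarrow> P (pure_tensor K U W u w)"
    and add: "\<And>s t. \<lbrakk>s \<in> carrier (tensor K U W); t \<in> carrier (tensor K U W); P s; P t\<rbrakk>
      \<Longrightarrow> P (s \<oplus>\<^bsub>tensor K U W\<^esub> t)"
  shows "P t"
proof -
  interpret U: module K U by fact
  interpret W: module K W by fact
  interpret T: module K "tensor K U W"
    by (rule tensor_is_module[OF U W])
  let ?F = "free_module K (carrier U \<times> carrier W)"
  interpret Q: quotient_module K ?F "tensor_kernel K U W"
    by (rule tensor_quotient_module[OF U W])
  have Q: "Q.coset \<in> module_hom K ?F (tensor K U W)"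
    unfolding tensor_def by (rule Q.coset_hom)
  obtain f where f: "f \<in> carrier ?F" "t = Q.coset f"
    using t unfolding tensor_def Q.carrier_quot by auto
  (* The scalar makes the induction go through: on a pure tensor it is absorbed by the left factor,
     so that no closure of P under scalars is required. *)
  have "\<forall>a\<in>carrier K. P (a \<odot>\<^bsub>tensor K U W\<^esub> Q.coset f)"
    using U.is_cring f(1)
  proof (induction f rule: free_module_induct)
    case zero
    have "Q.coset (\<lambda>p. \<zero>\<^bsub>K\<^esub>) = \<zero>\<^bsub>tensor K U W\<^esub>"
      using module_hom_zero[OF Q.M.module_axioms T.module_axioms Q] by simp
    also have "\<dots> = pure_tensor K U W \<zero>\<^bsub>U\<^esub> \<zero>\<^bsub>W\<^esub>"
      using module_hom_zero[OF U T.module_axioms pure_tensor_hom(2)[OF U W, of "\<zero>\<^bsub>W\<^esub>"]] by simp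
    finally show ?case
      using pure[of "\<zero>\<^bsub>U\<^esub>" "\<zero>\<^bsub>W\<^esub>"] pure_tensor_smult[OF U W, of _ "\<zero>\<^bsub>U\<^esub>" "\<zero>\<^bsub>W\<^esub>"] by auto
  next
    case (unit p)
    then obtain u w where p: "p = (u, w)" "u \<in> carrier U" "w \<in> carrier W"
      by auto
    have "a \<odot>\<^bsub>tensor K U W\<^esub> Q.coset (unit_vec_at K p) = pure_tensor K U W (a \<odot>\<^bsub>U\<^esub> u) w"
      if "a \<in> carrier K" for a
      using pure_tensor_smult(1)[OF U W that p(2,3)] by (simp add: p(1) pure_tensor_def)
    then show ?case
      using pure p by auto
  next
    case (add f g)
    then show ?case
      using module_hom_add[OF Q add.hyps] module_hom_in_carrier[OF Q]
      by (auto simp: T.smult_r_distr intro!: assms(5))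
  next
    case (smult a f)
    then show ?case
      using module_hom_smult[OF Q smult.hyps] module_hom_in_carrier[OF Q]
      by (auto simp flip: T.smult_assoc1)
  qed
  then show ?thesis
    using T.smult_one t f(2) U.R.one_closed by metis
qed

lemma tensor_hom_eqI:
  assumes U: "module K U" and W: "module K W"
    and g: "g \<in> module_hom K (tensor K U W) M" and h: "h \<in> module_hom K (tensor K U W) M"
    and eq: "\<And>u w. \<lbrakk>u \<in> carrier U; w \<in> carrier W\<rbrakk>
      \<Longrightarrow> g (pure_tensor K U W u w) = h (pure_tensor K U W u w)"
    and t: "t \<in> carrier (tensor K U W)"
  shows "g t = h t"
  using U W t
proof (induction rule: tensor_induct)
  case (add s t)
  then show ?case
    by (simp add: module_hom_add[OF g] module_hom_add[OF h])
qed (rule eq)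

lemma tensor_gen_set_hom_eqI:
  assumes U: "module K U" and W: "module K W" and M: "module K M"
    and g: "g \<in> module_hom K (tensor K U W) M" and h: "h \<in> module_hom K (tensor K U W) M"
    and genU: "module.span K U B = carrier U" and B: "B \<subseteq> carrier U"
    and genW: "module.span K W C = carrier W" and C: "C \<subseteq> carrier W"
    and eq: "\<And>x y. x \<in> B \<Longrightarrow> y \<in> C \<Longrightarrow> g (pure_tensor K U W x y) = h (pure_tensor K U W x y)"
    and t: "t \<in> carrier (tensor K U W)"
  shows "g t = h t"
proof (rule tensor_hom_eqI[OF U W g h _ t])
  fix u w assume u: "u \<in> carrier U" and w: "w \<in> carrier W"
  note gt = module_hom_comp_bilinear[OF bilinear_pure_tensor[OF U W] g]
    and ht = module_hom_comp_bilinear[OF bilinear_pure_tensor[OF U W] h]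
  have "g (pure_tensor K U W u y) = h (pure_tensor K U W u y)" if y: "y \<in> C" for y
  proof -
    have y': "y \<in> carrier W"
      using C y by blast
    show ?thesis
      by (rule gen_set_hom_eqI[OF U M bilinear_mapD(2)[OF gt y'] bilinear_mapD(2)[OF ht y'] genU
            eq[OF _ y] B u])
  qed
  then show "g (pure_tensor K U W u w) = h (pure_tensor K U W u w)"
    by (rule gen_set_hom_eqI[OF W M bilinear_mapD(1)[OF gt u] bilinear_mapD(1)[OF ht u] genW _ C w])
qed

text \<open>
  The universal property of the tensor product: the linear extension of a bilinear map kills every
  bilinearity relator, so its kernel, being a submodule, contains their span.
\<close>

lemma tensor_lift_well_defined:
  assumes U: "module K U" and W: "module K W" and M: "module K M"
    and b: "bilinear_map K U W M b"
  shows "tensor_lift K M b \<in> module_hom K (tensor K U W) M"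
    and "u \<in> carrier U \<Longrightarrow> w \<in> carrier W \<Longrightarrow> tensor_lift K M b (pure_tensor K U W u w) = b u w"
proof -
  interpret U: module K U by fact
  interpret W: module K W by fact
  interpret M: module K M by fact
  let ?S = "carrier U \<times> carrier W"
  let ?F = "free_module K ?S" and ?e = "unit_vec_at K"
  let ?h = "linear_extension K M (\<lambda>p. b (fst p) (snd p))"
  interpret Q: quotient_module K ?F "tensor_kernel K U W"
    by (rule tensor_quotient_module[OF U W])
  note b1 = bilinear_mapD(1)[OF b] and b2 = bilinear_mapD(2)[OF b]
  have b_closed: "b u w \<in> carrier M" if "u \<in> carrier U" "w \<in> carrier W" for u w
    using module_hom_in_carrier[OF b1] that by blast
  have h: "?h \<in> module_hom K ?F M"
    by (rule linear_extension_hom[OF M]) (auto intro: b_closed)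
  interpret h: mod_hom K ?F M ?h
    using Q.module M h by (simp add: mod_hom_def mod_hom_axioms_def)
  have unit: "?h (?e (u, w)) = b u w" if "u \<in> carrier U" "w \<in> carrier W" for u w
    using linear_extension_unit[OF M, of ?S "\<lambda>p. b (fst p) (snd p)" "(u, w)"] that b_closed by auto
  have e [simp]: "?e (u, w) \<in> carrier ?F" if "u \<in> carrier U" "w \<in> carrier W" for u w
    using that by (intro unit_vec_at_closed[OF U.is_cring]) auto
  note [simp del] = free_module_simps
  have "?h r = \<zero>\<^bsub>M\<^esub>" if "r \<in> bilinear_relators K U W" for r
    using that unfolding bilinear_relators_def Let_def
    by (auto simp: unit b_closed module_hom_add[OF b1] module_hom_add[OF b2]
        module_hom_smult[OF b1] module_hom_smult[OF b2])
  then have "bilinear_relators K U W \<subseteq> h.ker"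
    using bilinear_relators_closed[OF U W] by (auto simp: h.ker_def)
  then have "tensor_kernel K U W \<subseteq> h.ker"
    unfolding tensor_kernel_def by (rule Q.M.span_is_subset[OF _ h.ker_is_submodule])
  then have ker: "?h x = \<zero>\<^bsub>M\<^esub>" if "x \<in> tensor_kernel K U W" for x
    using that by (auto simp: h.ker_def)
  show "tensor_lift K M b \<in> module_hom K (tensor K U W) M"
    using Q.quot_hom[OF M h ker] unfolding tensor_lift_def tensor_def by simp
  show "tensor_lift K M b (pure_tensor K U W u w) = b u w"
    if "u \<in> carrier U" "w \<in> carrier W"
    using Q.the_elem_image_coset[OF M h ker e[OF that]] unit[OF that]
    unfolding tensor_lift_def pure_tensor_def by simp
qed

lemmas tensor_lift_hom = tensor_lift_well_defined(1)
  and tensor_lift_pure = tensor_lift_well_defined(2)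

lemma tensor_lift_cong:
  assumes "module K U" "module K W" "module K M"
    and b: "bilinear_map K U W M b" and b': "bilinear_map K U W M b'"
    and eq: "\<And>u w. u \<in> carrier U \<Longrightarrow> w \<in> carrier W \<Longrightarrow> b u w = b' u w"
    and t: "t \<in> carrier (tensor K U W)"
  shows "tensor_lift K M b t = tensor_lift K M b' t"
  by (rule tensor_hom_eqI[OF assms(1,2) tensor_lift_hom[OF assms(1-3) b]
        tensor_lift_hom[OF assms(1-3) b'] _ t])
    (simp add: tensor_lift_pure[OF assms(1-3) b] tensor_lift_pure[OF assms(1-3) b'] eq)

lemma tensor_map_well_defined:
  assumes U: "module K U" and W: "module K W" and U': "module K U'" and W': "module K W'"
    and f: "f \<in> module_hom K U U'" and g: "g \<in> module_hom K W W'"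
  shows "tensor_map K U' W' f g \<in> module_hom K (tensor K U W) (tensor K U' W')"
    and "u \<in> carrier U \<Longrightarrow> w \<in> carrier W \<Longrightarrow>
      tensor_map K U' W' f g (pure_tensor K U W u w) = pure_tensor K U' W' (f u) (g w)"
proof -
  have b: "bilinear_map K U W (tensor K U' W') (\<lambda>u w. pure_tensor K U' W' (f u) (g w))"
    by (rule bilinear_map_comp[OF bilinear_pure_tensor[OF U' W'] f g])
  note T = tensor_is_module[OF U' W']
  show "tensor_map K U' W' f g \<in> module_hom K (tensor K U W) (tensor K U' W')"
    unfolding tensor_map_def by (rule tensor_lift_hom[OF U W T b])
  show "tensor_map K U' W' f g (pure_tensor K U W u w) = pure_tensor K U' W' (f u) (g w)"
    if "u \<in> carrier U" "w \<in> carrier W"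
    unfolding tensor_map_def by (rule tensor_lift_pure[OF U W T b that])
qed

lemmas tensor_map_hom = tensor_map_well_defined(1)
  and tensor_map_pure = tensor_map_well_defined(2)

lemma tensor_lift_tensor_map:
  assumes U: "module K U" and W: "module K W" and U': "module K U'" and W': "module K W'"
    and f: "f \<in> module_hom K U U'" and g: "g \<in> module_hom K W W'"
    and M: "module K M" and b: "bilinear_map K U' W' M b"
    and t: "t \<in> carrier (tensor K U W)"
  shows "tensor_lift K M b (tensor_map K U' W' f g t) = tensor_lift K M (\<lambda>u w. b (f u) (g w)) t"
proof -
  note fg = tensor_map_hom[OF U W U' W' f g]
  note b' = bilinear_map_comp[OF b f g]
  show ?thesis
    by (rule tensor_hom_eqI[OF U W module_hom_comp[OF fg tensor_lift_hom[OF U' W' M b]]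
          tensor_lift_hom[OF U W M b'] _ t])
      (simp add: tensor_map_pure[OF U W U' W' f g] tensor_lift_pure[OF U' W' M b]
        tensor_lift_pure[OF U W M b'] module_hom_in_carrier[OF f] module_hom_in_carrier[OF g])
qed

section \<open>Algebras and their tensor products\<close>

definition unital_algebra :: "('k, 'c) ring_scheme \<Rightarrow> ('k, 'a, 'd) module_scheme \<Rightarrow> bool" where
  "unital_algebra K A \<longleftrightarrow> module K A \<and> ring A \<and> bilinear_map K A A A (mult A)"

lemma unital_algebra_carrier:
  assumes "unital_algebra K A" "x \<in> carrier A" "y \<in> carrier A"
  shows "x \<otimes>\<^bsub>A\<^esub> y \<in> carrier A"
proof -
  interpret ring A
    using assms(1) by (simp add: unital_algebra_def)
  show ?thesis
    using assms(2,3) by simp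
qed

lemma unital_algebra_smult:
  assumes "unital_algebra K A" "a \<in> carrier K" "x \<in> carrier A" "y \<in> carrier A"
  shows "(a \<odot>\<^bsub>A\<^esub> x) \<otimes>\<^bsub>A\<^esub> y = a \<odot>\<^bsub>A\<^esub> (x \<otimes>\<^bsub>A\<^esub> y)"
    and "x \<otimes>\<^bsub>A\<^esub> (a \<odot>\<^bsub>A\<^esub> y) = a \<odot>\<^bsub>A\<^esub> (x \<otimes>\<^bsub>A\<^esub> y)"
  using assms unfolding unital_algebra_def
  by (auto dest: bilinear_mapD intro: module_hom_smult[of "\<lambda>x. x \<otimes>\<^bsub>A\<^esub> y" K A A a x]
      module_hom_smult[of "\<lambda>y. x \<otimes>\<^bsub>A\<^esub> y" K A A a y])

lemma unital_algebra_smult_smult: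
  assumes A: "unital_algebra K A" and a: "a \<in> carrier K" "b \<in> carrier K"
    and x: "x \<in> carrier A" "y \<in> carrier A"
  shows "(a \<odot>\<^bsub>A\<^esub> x) \<otimes>\<^bsub>A\<^esub> (b \<odot>\<^bsub>A\<^esub> y) = (a \<otimes>\<^bsub>K\<^esub> b) \<odot>\<^bsub>A\<^esub> (x \<otimes>\<^bsub>A\<^esub> y)"
proof -
  interpret module K A
    using A by (simp add: unital_algebra_def)
  show ?thesis
    using unital_algebra_smult(1)[OF A a(1) x(1) smult_closed[OF a(2) x(2)]]
      unital_algebra_smult(2)[OF A a(2) x] smult_assoc1[OF a unital_algebra_carrier[OF A x]] by simp
qed

lemma algebra_homD:
  assumes "f \<in> algebra_hom K A B"
  shows "f \<in> module_hom K A B" "f \<one>\<^bsub>A\<^esub> = \<one>\<^bsub>B\<^esub>"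
    and "x \<in> carrier A \<Longrightarrow> y \<in> carrier A \<Longrightarrow> f (x \<otimes>\<^bsub>A\<^esub> y) = f x \<otimes>\<^bsub>B\<^esub> f y"
  using assms by (auto simp: algebra_hom_def ring_hom_one ring_hom_mult)

lemma algebra_homI:
  assumes "h \<in> module_hom K A B" "h \<one>\<^bsub>A\<^esub> = \<one>\<^bsub>B\<^esub>"
    and "\<And>x y. x \<in> carrier A \<Longrightarrow> y \<in> carrier A \<Longrightarrow> h (x \<otimes>\<^bsub>A\<^esub> y) = h x \<otimes>\<^bsub>B\<^esub> h y"
  shows "h \<in> algebra_hom K A B"
  unfolding algebra_hom_def
  using assms module_hom_in_carrier[OF assms(1)] module_hom_add[OF assms(1)]
  by (auto intro!: ring_hom_memI)

lemma algebra_hom_kernel_ideal: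
  assumes "unital_algebra K A" "unital_algebra K B" "h \<in> algebra_hom K A B"
  shows "ideal {x \<in> carrier A. h x = \<zero>\<^bsub>B\<^esub>} A"
proof -
  interpret ring_hom_ring A B h
    using assms by (intro ring_hom_ringI2) (auto simp: unital_algebra_def algebra_hom_def)
  show ?thesis
    by (rule kernel_is_ideal[unfolded a_kernel_def'])
qed

text \<open>
  A ring ideal of a unital algebra is closed under scalars, because a scalar acts as multiplication
  by a multiple of the unit.
\<close>

lemma ideal_quotient_module:
  assumes A: "unital_algebra K A" and J: "ideal J A"
  shows "quotient_module K A J"
proof (rule quotient_module.intro)
  interpret J: ideal J A by fact
  show M: "module K A"
    using A by (simp add: unital_algebra_def)
  interpret A: module K A by fact
  have "a \<odot>\<^bsub>A\<^esub> x \<in> J" if a: "a \<in> carrier K" and x: "x \<in> J" for a x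
  proof -
    have xA: "x \<in> carrier A"
      using J.a_subset x by blast
    have "a \<odot>\<^bsub>A\<^esub> x = (a \<odot>\<^bsub>A\<^esub> \<one>\<^bsub>A\<^esub>) \<otimes>\<^bsub>A\<^esub> x"
      using unital_algebra_smult(1)[OF A a J.one_closed xA] xA by simp
    also have "\<dots> \<in> J"
      using x a J.one_closed by (intro J.I_l_closed) auto
    finally show ?thesis .
  qed
  then show "submodule K J A"
    using J.a_subset by (intro submodule.intro M) auto
qed

lemma quotient_algebra:
  assumes A: "unital_algebra K A" and J: "ideal J A"
  shows "unital_algebra K (quot_module A J)"
    and "(\<lambda>x. J +>\<^bsub>A\<^esub> x) \<in> algebra_hom K A (quot_module A J)"
proof -
  interpret Q: quotient_module K A J
    by (rule ideal_quotient_module[OF A J])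
  interpret J: ideal J A by fact
  let ?Q = "quot_module A J"
  have mult: "Q.coset x \<otimes>\<^bsub>?Q\<^esub> Q.coset y = Q.coset (x \<otimes>\<^bsub>A\<^esub> y)"
    if "x \<in> carrier A" "y \<in> carrier A" for x y
    using J.rcoset_mult_add[OF that] by (simp add: quot_module_def FactRing_def)
  have one: "\<one>\<^bsub>?Q\<^esub> = Q.coset \<one>\<^bsub>A\<^esub>"
    by (simp add: quot_module_def FactRing_def)
  have "ring ?Q"
    by (intro ringI monoidI module.axioms(2)[OF Q.quot_module_is_module])
      (auto simp: Q.carrier_quot Q.add_quot mult one J.l_distr J.r_distr J.m_assoc)
  moreover have "bilinear_map K ?Q ?Q ?Q (mult ?Q)"
    using unital_algebra_smult[OF A]
    by (intro bilinear_mapI module_homI)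
      (auto simp: Q.carrier_quot Q.add_quot Q.smult_quot mult J.l_distr J.r_distr)
  ultimately show "unital_algebra K ?Q"
    using Q.quot_module_is_module by (simp add: unital_algebra_def)
  show "Q.coset \<in> algebra_hom K A ?Q"
    by (rule algebra_homI[OF Q.coset_hom]) (simp_all add: one mult)
qed

lemma tensor_algebra_simps [simp]:
  "carrier (tensor_algebra K A B) = carrier (tensor K A B)"
  "zero (tensor_algebra K A B) = zero (tensor K A B)"
  "add (tensor_algebra K A B) = add (tensor K A B)"
  "smult (tensor_algebra K A B) = smult (tensor K A B)"
  "one (tensor_algebra K A B) = pure_tensor K A B \<one>\<^bsub>A\<^esub> \<one>\<^bsub>B\<^esub>"
  by (simp_all add: tensor_algebra_def)

text \<open>
  Bilinearity and the value on pure tensors determine the product; its definition as a nested lift is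
  not unfolded again.
\<close>

lemma tensor_algebra_mult:
  assumes A: "unital_algebra K A" and B: "unital_algebra K B"
  defines "T \<equiv> tensor K A B"
  shows "bilinear_map K T T T (mult (tensor_algebra K A B))"
    and "\<lbrakk>a \<in> carrier A; b \<in> carrier B; a' \<in> carrier A; b' \<in> carrier B\<rbrakk> \<Longrightarrow>
      pure_tensor K A B a b \<otimes>\<^bsub>tensor_algebra K A B\<^esub> pure_tensor K A B a' b' =
        pure_tensor K A B (a \<otimes>\<^bsub>A\<^esub> a') (b \<otimes>\<^bsub>B\<^esub> b')"
proof -
  let ?t = "pure_tensor K A B"
  have A': "module K A" "bilinear_map K A A A (mult A)"
    and B': "module K B" "bilinear_map K B B B (mult B)"
    using A B by (auto simp: unital_algebra_def)
  have T: "module K T"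
    unfolding T_def using A'(1) B'(1) by (rule tensor_is_module)
  interpret T: module K T by fact
  have t: "bilinear_map K A B T ?t"
    unfolding T_def by (rule bilinear_pure_tensor[OF A'(1) B'(1)])
  (* The product is a lift of a lift: the inner one is a map in the second argument for fixed a and
     b, and its value is in turn bilinear in a and b. *)
  let ?m = "\<lambda>a b. tensor_lift K T (\<lambda>a' b'. ?t (a \<otimes>\<^bsub>A\<^esub> a') (b \<otimes>\<^bsub>B\<^esub> b'))"
  have inner: "bilinear_map K A B T (\<lambda>a' b'. ?t (a \<otimes>\<^bsub>A\<^esub> a') (b \<otimes>\<^bsub>B\<^esub> b'))"
    if "a \<in> carrier A" "b \<in> carrier B" for a b
    using that by (intro bilinear_map_comp[OF t] bilinear_mapD(1)[OF A'(2)] bilinear_mapD(1)[OF B'(2)])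
  have m_hom: "?m a b \<in> module_hom K T T" if "a \<in> carrier A" "b \<in> carrier B" for a b
    unfolding T_def
    using tensor_lift_hom[OF A'(1) B'(1) T inner[OF that]] by (simp add: T_def)
  have m_pure: "?m a b (?t a' b') = ?t (a \<otimes>\<^bsub>A\<^esub> a') (b \<otimes>\<^bsub>B\<^esub> b')"
    if "a \<in> carrier A" "b \<in> carrier B" "a' \<in> carrier A" "b' \<in> carrier B" for a b a' b'
    by (rule tensor_lift_pure[OF A'(1) B'(1) T inner[OF that(1,2)] that(3,4)])
  have outer: "bilinear_map K A B T (\<lambda>a b. ?m a b Y)" if Y: "Y \<in> carrier T" for Y
    using A'(1) B'(1) Y[unfolded T_def]
  proof (induction Y rule: tensor_induct)
    case (pure a' b')
    have "bilinear_map K A B T (\<lambda>a b. ?t (a \<otimes>\<^bsub>A\<^esub> a') (b \<otimes>\<^bsub>B\<^esub> b'))"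
      using pure by (intro bilinear_map_comp[OF t] bilinear_mapD(2)[OF A'(2)] bilinear_mapD(2)[OF B'(2)])
    then show ?case
      by (rule bilinear_map_cong[OF A'(1) B'(1)]) (rule m_pure[OF _ _ pure])
  next
    case (add X Y)
    have XY: "X \<in> carrier T" "Y \<in> carrier T"
      using add.hyps by (simp_all add: T_def)
    have "?m a b (X \<oplus>\<^bsub>T\<^esub> Y) = ?m a b X \<oplus>\<^bsub>T\<^esub> ?m a b Y" if "a \<in> carrier A" "b \<in> carrier B" for a b
      by (rule module_hom_add[OF m_hom[OF that] XY])
    then have "bilinear_map K A B T (\<lambda>a b. ?m a b (X \<oplus>\<^bsub>T\<^esub> Y))"
      by (rule bilinear_map_cong[OF A'(1) B'(1) bilinear_map_add[OF T add.IH]])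
    then show ?case
      by (simp add: T_def)
  qed
  have mult: "X \<otimes>\<^bsub>tensor_algebra K A B\<^esub> Y = tensor_lift K T (\<lambda>a b. ?m a b Y) X" for X Y
    by (simp add: tensor_algebra_def T_def)
  have left: "(\<lambda>X. X \<otimes>\<^bsub>tensor_algebra K A B\<^esub> Y) \<in> module_hom K T T" if "Y \<in> carrier T" for Y
    unfolding mult using tensor_lift_hom[OF A'(1) B'(1) T outer[OF that]] by (simp add: T_def)
  have pure_left: "?t a b \<otimes>\<^bsub>tensor_algebra K A B\<^esub> Y = ?m a b Y"
    if "a \<in> carrier A" "b \<in> carrier B" "Y \<in> carrier T" for a b Y
    unfolding mult by (rule tensor_lift_pure[OF A'(1) B'(1) T outer[OF that(3)] that(1,2)])
  have right: "mult (tensor_algebra K A B) X \<in> module_hom K T T" if X: "X \<in> carrier T" for X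
    using A'(1) B'(1) X[unfolded T_def]
  proof (induction X rule: tensor_induct)
    case (pure a b)
    show ?case
      by (rule module_hom_cong[OF T m_hom[OF pure]]) (rule pure_left[OF pure])
  next
    case (add X X')
    have XX': "X \<in> carrier T" "X' \<in> carrier T"
      using add.hyps by (simp_all add: T_def)
    have "mult (tensor_algebra K A B) (X \<oplus>\<^bsub>T\<^esub> X') \<in> module_hom K T T"
      by (rule module_hom_cong[OF T module_hom_sum[OF T add.IH]])
        (rule module_hom_add[OF left XX'])
    then show ?case
      by (simp add: T_def)
  qed
  show "bilinear_map K T T T (mult (tensor_algebra K A B))"
    by (rule bilinear_mapI[OF right left])
  show "?t a b \<otimes>\<^bsub>tensor_algebra K A B\<^esub> ?t a' b' = ?t (a \<otimes>\<^bsub>A\<^esub> a') (b \<otimes>\<^bsub>B\<^esub> b')"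
    if ab: "a \<in> carrier A" "b \<in> carrier B" "a' \<in> carrier A" "b' \<in> carrier B"
  proof -
    have "?t a' b' \<in> carrier T"
      unfolding T_def by (rule pure_tensor_closed[OF A'(1) B'(1) ab(3,4)])
    then show ?thesis
      using pure_left[OF ab(1,2)] m_pure[OF ab] by simp
  qed
qed

text \<open>Both sides are bilinear in \<open>X\<close> and \<open>Y\<close>, so that pure tensors suffice.\<close>

lemma tensor_map_mult:
  assumes A: "unital_algebra K A" and B: "unital_algebra K B"
    and A': "unital_algebra K A'" and B': "unital_algebra K B'"
    and f: "f \<in> algebra_hom K A A'" and g: "g \<in> algebra_hom K B B'"
    and X: "X \<in> carrier (tensor K A B)" and Y: "Y \<in> carrier (tensor K A B)"
  shows "tensor_map K A' B' f g (X \<otimes>\<^bsub>tensor_algebra K A B\<^esub> Y) =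
    tensor_map K A' B' f g X \<otimes>\<^bsub>tensor_algebra K A' B'\<^esub> tensor_map K A' B' f g Y"
    (is "?fg (X \<otimes>\<^bsub>?T\<^esub> Y) = ?fg X \<otimes>\<^bsub>?T'\<^esub> ?fg Y")
proof -
  have M: "module K A" "module K B" "module K A'" "module K B'"
    using A B A' B' by (auto simp: unital_algebra_def)
  note f' = algebra_homD(1)[OF f] and g' = algebra_homD(1)[OF g]
  note fg = tensor_map_hom[OF M f' g'] and fg_pure = tensor_map_pure[OF M f' g']
  note mult = tensor_algebra_mult(1)[OF A B] and mult' = tensor_algebra_mult(1)[OF A' B']
  note mult_pure = tensor_algebra_mult(2)[OF A B] and mult_pure' = tensor_algebra_mult(2)[OF A' B']
  note closed = module_hom_in_carrier[OF f'] module_hom_in_carrier[OF g']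
    unital_algebra_carrier[OF A] unital_algebra_carrier[OF B]
  have pure: "?fg (X \<otimes>\<^bsub>?T\<^esub> pure_tensor K A B a b) = ?fg X \<otimes>\<^bsub>?T'\<^esub> ?fg (pure_tensor K A B a b)"
    if ab: "a \<in> carrier A" "b \<in> carrier B" for a b
  proof -
    note t = pure_tensor_closed[OF M(1,2) ab]
    note l = bilinear_mapD(2)[OF mult t]
      and r = bilinear_mapD(2)[OF mult' module_hom_in_carrier[OF fg t]]
    show ?thesis
      by (rule tensor_hom_eqI[OF M(1,2) module_hom_comp[OF l fg] module_hom_comp[OF fg r] _ X])
        (simp add: fg_pure mult_pure mult_pure' ab closed algebra_homD(3)[OF f] algebra_homD(3)[OF g])
  qed
  show ?thesis
    by (rule tensor_hom_eqI[OF M(1,2) module_hom_comp[OF bilinear_mapD(1)[OF mult X] fg]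
          module_hom_comp[OF fg bilinear_mapD(1)[OF mult' module_hom_in_carrier[OF fg X]]] _ Y])
      (rule pure)
qed

section \<open>Free algebras\<close>

lemma free_algebra_simps [simp]:
  "carrier (free_algebra K S) = carrier (free_module K (lists S))"
  "zero (free_algebra K S) = zero (free_module K (lists S))"
  "add (free_algebra K S) = add (free_module K (lists S))"
  "smult (free_algebra K S) = smult (free_module K (lists S))"
  "one (free_algebra K S) = unit_vec_at K []"
  by (simp_all add: free_algebra_def)

lemma free_algebra_mult:
  "f \<otimes>\<^bsub>free_algebra K S\<^esub> g = (\<lambda>w. \<Oplus>\<^bsub>K\<^esub>i\<in>{..length w}. f (take i w) \<otimes>\<^bsub>K\<^esub> g (drop i w))"
  by (simp add: free_algebra_def)

text \<open>Only the cut of \<open>w\<close> at position \<open>length u\<close> can contribute to the convolution.\<close>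

lemma free_algebra_mult_word:
  assumes "cring K"
  shows "unit_vec_at K u \<otimes>\<^bsub>free_algebra K S\<^esub> unit_vec_at K v = unit_vec_at K (u @ v)"
proof
  fix w
  interpret cring K by fact
  have split: "take i w = u \<and> drop i w = v \<longleftrightarrow> i = length u \<and> w = u @ v" if "i \<le> length w" for i
    using that by (metis append_eq_conv_conj append_take_drop_id length_take min.absorb2)
  have "(unit_vec_at K u \<otimes>\<^bsub>free_algebra K S\<^esub> unit_vec_at K v) w =
      (\<Oplus>\<^bsub>K\<^esub>i\<in>{..length w}. if length u = i then unit_vec_at K (u @ v) w else \<zero>\<^bsub>K\<^esub>)"
    unfolding free_algebra_mult
  proof (rule finsum_cong')
    fix i assume "i \<in> {..length w}"
    then show "unit_vec_at K u (take i w) \<otimes>\<^bsub>K\<^esub> unit_vec_at K v (drop i w) =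
        (if length u = i then unit_vec_at K (u @ v) w else \<zero>\<^bsub>K\<^esub>)"
      using split[of i] by (auto simp: unit_vec_at_def)
  qed (auto simp: unit_vec_at_def)
  also have "\<dots> = unit_vec_at K (u @ v) w"
  proof (cases "length u \<le> length w")
    case True
    then show ?thesis
      by (intro add.finprod_singleton) (auto simp: unit_vec_at_def)
  next
    case False
    then have "(\<Oplus>\<^bsub>K\<^esub>i\<in>{..length w}. if length u = i then unit_vec_at K (u @ v) w else \<zero>\<^bsub>K\<^esub>) =
        (\<Oplus>\<^bsub>K\<^esub>i\<in>{..length w}. \<zero>\<^bsub>K\<^esub>)"
      by (intro finsum_cong') auto
    with False show ?thesis
      by (auto simp: unit_vec_at_def)
  qed
  finally show "(unit_vec_at K u \<otimes>\<^bsub>free_algebra K S\<^esub> unit_vec_at K v) w = unit_vec_at K (u @ v) w" .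
qed

lemma free_algebra_is_module:
  assumes "cring K"
  shows "module K (free_algebra K S)"
  by (rule module_record_cong[OF free_module_is_module[OF assms]]) simp_all

text \<open>
  The convolution product is bilinear and concatenates basis words; hence closure, associativity and
  the unit laws only have to be checked on words.
\<close>

lemma free_algebra_unital_algebra:
  assumes K: "cring K"
  shows "unital_algebra K (free_algebra K S)"
proof -
  interpret cring K by fact
  let ?F = "free_algebra K S" and ?e = "unit_vec_at K"
  interpret F: module K ?F
    by (rule free_algebra_is_module[OF K])
  have coeff: "f w \<in> carrier K" if "f \<in> carrier ?F" for f w
    using that free_module_coeff[OF K] by simp
  have add_left: "(f \<oplus>\<^bsub>?F\<^esub> g) \<otimes>\<^bsub>?F\<^esub> h = f \<otimes>\<^bsub>?F\<^esub> h \<oplus>\<^bsub>?F\<^esub> g \<otimes>\<^bsub>?F\<^esub> h"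
    and add_right: "h \<otimes>\<^bsub>?F\<^esub> (f \<oplus>\<^bsub>?F\<^esub> g) = h \<otimes>\<^bsub>?F\<^esub> f \<oplus>\<^bsub>?F\<^esub> h \<otimes>\<^bsub>?F\<^esub> g"
    if "f \<in> carrier ?F" "g \<in> carrier ?F" "h \<in> carrier ?F" for f g h
    using coeff[OF that(1)] coeff[OF that(2)] coeff[OF that(3)]
    by (simp_all add: free_algebra_mult fun_eq_iff l_distr r_distr finsum_addf Pi_def)
  have smult_left: "(a \<odot>\<^bsub>?F\<^esub> f) \<otimes>\<^bsub>?F\<^esub> h = a \<odot>\<^bsub>?F\<^esub> (f \<otimes>\<^bsub>?F\<^esub> h)"
    and smult_right: "h \<otimes>\<^bsub>?F\<^esub> (a \<odot>\<^bsub>?F\<^esub> f) = a \<odot>\<^bsub>?F\<^esub> (h \<otimes>\<^bsub>?F\<^esub> f)"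
    if "a \<in> carrier K" "f \<in> carrier ?F" "h \<in> carrier ?F" for a f h
    using that(1) coeff[OF that(2)] coeff[OF that(3)]
    by (simp_all add: free_algebra_mult fun_eq_iff finsum_rdistr m_lcomm m_assoc Pi_def)
  have word: "?e u \<otimes>\<^bsub>?F\<^esub> ?e v = ?e (u @ v)" for u v
    by (rule free_algebra_mult_word[OF K])
  have e: "?e w \<in> carrier ?F" if "w \<in> lists S" for w
    using unit_vec_at_closed[OF K that] by simp
  have ind: "P f" if f: "f \<in> carrier ?F"
    and "P \<zero>\<^bsub>?F\<^esub>" "\<And>w. w \<in> lists S \<Longrightarrow> P (?e w)"
    and "\<And>f g. \<lbrakk>f \<in> carrier ?F; g \<in> carrier ?F; P f; P g\<rbrakk> \<Longrightarrow> P (f \<oplus>\<^bsub>?F\<^esub> g)"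
    and "\<And>a f. \<lbrakk>a \<in> carrier K; f \<in> carrier ?F; P f\<rbrakk> \<Longrightarrow> P (a \<odot>\<^bsub>?F\<^esub> f)" for P f
    using K f[simplified] by (rule free_module_induct) (use that in simp_all)
  have zero_left: "\<zero>\<^bsub>?F\<^esub> \<otimes>\<^bsub>?F\<^esub> h = \<zero>\<^bsub>?F\<^esub>" and zero_right: "h \<otimes>\<^bsub>?F\<^esub> \<zero>\<^bsub>?F\<^esub> = \<zero>\<^bsub>?F\<^esub>"
    if "h \<in> carrier ?F" for h
    using coeff[OF that] by (simp_all add: free_algebra_mult)
  note [simp del] = free_algebra_simps(1-4)
  note lin = add_left add_right smult_left smult_right zero_left zero_right
  have closed: "f \<otimes>\<^bsub>?F\<^esub> g \<in> carrier ?F" if f: "f \<in> carrier ?F" and g: "g \<in> carrier ?F" for f g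
  proof -
    have "?e u \<otimes>\<^bsub>?F\<^esub> g \<in> carrier ?F" if u: "u \<in> lists S" for u
      using g by (rule ind) (use u e word in \<open>simp_all add: lin\<close>)
    then show ?thesis
      by - (rule ind[OF f], use g in \<open>simp_all add: lin\<close>)
  qed
  have assoc: "(f \<otimes>\<^bsub>?F\<^esub> g) \<otimes>\<^bsub>?F\<^esub> h = f \<otimes>\<^bsub>?F\<^esub> (g \<otimes>\<^bsub>?F\<^esub> h)"
    if f: "f \<in> carrier ?F" and g: "g \<in> carrier ?F" and h: "h \<in> carrier ?F" for f g h
  proof -
    have 1: "(?e u \<otimes>\<^bsub>?F\<^esub> ?e v) \<otimes>\<^bsub>?F\<^esub> h = ?e u \<otimes>\<^bsub>?F\<^esub> (?e v \<otimes>\<^bsub>?F\<^esub> h)"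
      if "u \<in> lists S" "v \<in> lists S" for u v
      using h by (rule ind) (use that e[OF that(1)] e[OF that(2)] word in \<open>simp_all add: lin closed e\<close>)
    have 2: "(?e u \<otimes>\<^bsub>?F\<^esub> g) \<otimes>\<^bsub>?F\<^esub> h = ?e u \<otimes>\<^bsub>?F\<^esub> (g \<otimes>\<^bsub>?F\<^esub> h)" if "u \<in> lists S" for u
      using g by (rule ind) (use h 1 that e[OF that] in \<open>simp_all add: lin closed\<close>)
    show ?thesis
      using f by (rule ind) (use g h 2 in \<open>simp_all add: lin closed\<close>)
  qed
  have one: "\<one>\<^bsub>?F\<^esub> \<in> carrier ?F"
    using e[of "[]"] by simp
  have unit: "\<one>\<^bsub>?F\<^esub> \<otimes>\<^bsub>?F\<^esub> f = f" "f \<otimes>\<^bsub>?F\<^esub> \<one>\<^bsub>?F\<^esub> = f" if f: "f \<in> carrier ?F" for f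
    using f by (rule ind; use one word in \<open>simp add: lin\<close>)+
  have "ring ?F"
    by (intro ringI F.M.abelian_group_axioms monoidI) (simp_all add: closed one assoc unit lin del: free_algebra_simps)
  moreover have "bilinear_map K ?F ?F ?F (mult ?F)"
    by (intro bilinear_mapI module_homI) (simp_all add: closed lin)
  ultimately show ?thesis
    using F.module_axioms by (simp add: unital_algebra_def)
qed

definition word_prod :: "('a, 'd) monoid_scheme \<Rightarrow> ('x \<Rightarrow> 'a) \<Rightarrow> 'x list \<Rightarrow> 'a" where
  "word_prod G b w = foldr (\<lambda>p y. b p \<otimes>\<^bsub>G\<^esub> y) w \<one>\<^bsub>G\<^esub>"

lemma (in monoid) word_prod_closed:
  assumes "\<And>p. p \<in> S \<Longrightarrow> b p \<in> carrier G" "w \<in> lists S"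
  shows "word_prod G b w \<in> carrier G"
  using assms(2) by induction (simp_all add: word_prod_def assms(1))

lemma (in monoid) word_prod_append:
  assumes b: "\<And>p. p \<in> S \<Longrightarrow> b p \<in> carrier G" and u: "u \<in> lists S" and v: "v \<in> lists S"
  shows "word_prod G b (u @ v) = word_prod G b u \<otimes> word_prod G b v"
  using u
proof induction
  case Nil
  then show ?case
    using word_prod_closed[of S b v] b v by (simp add: word_prod_def)
next
  case (Cons p u)
  then show ?case
    using word_prod_closed[of S b u] word_prod_closed[of S b v] v
    by (simp add: word_prod_def b m_assoc)
qed

text \<open>
  The universal property of the free algebra. The linear extension of \<open>word_prod\<close> is multiplicative
  because both sides of the claim are bilinear and agree on words.
\<close>

lemma free_algebra_lift:
  assumes B: "unital_algebra K B" and b: "\<And>p. p \<in> S \<Longrightarrow> b p \<in> carrier B"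
  defines "h \<equiv> linear_extension K B (word_prod B b)"
  shows "h \<in> algebra_hom K (free_algebra K S) B"
    and "p \<in> S \<Longrightarrow> h (unit_vec_at K [p]) = b p"
proof -
  let ?F = "free_algebra K S" and ?e = "unit_vec_at K"
  have M: "module K B"
    using B by (simp add: unital_algebra_def)
  interpret B: ring B
    using B by (simp add: unital_algebra_def)
  have K: "cring K"
    by (rule module.axioms(1)[OF M])
  have w: "word_prod B b w \<in> carrier B" if "w \<in> lists S" for w
    by (rule B.word_prod_closed[OF b that])
  have e: "?e w \<in> carrier ?F" if "w \<in> lists S" for w
    using unit_vec_at_closed[OF K that] by simp
  have hom: "h \<in> module_hom K ?F B"
    using linear_extension_hom[OF M w] by (simp add: h_def module_hom_def)
  have unit: "h (?e w) = word_prod B b w" if "w \<in> lists S" for w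
    unfolding h_def by (rule linear_extension_unit[OF M w that])
  have F: "unital_algebra K ?F"
    by (rule free_algebra_unital_algebra[OF K])
  have Fm: "bilinear_map K ?F ?F ?F (mult ?F)" "bilinear_map K B B B (mult B)"
    using F B by (simp_all add: unital_algebra_def)
  have eqI: "g f = g' f" if "g \<in> module_hom K ?F B" "g' \<in> module_hom K ?F B"
    "\<And>w. w \<in> lists S \<Longrightarrow> g (?e w) = g' (?e w)" "f \<in> carrier ?F" for g g' f
    using K that(4)[simplified]
  proof (induction rule: free_module_induct)
    case zero
    then show ?case
      using module_hom_zero[OF free_algebra_is_module[OF K, of S] M that(1)]
        module_hom_zero[OF free_algebra_is_module[OF K, of S] M that(2)] by simp
  next
    case (add f f')
    then show ?case
      using module_hom_add[OF that(1), of f f'] module_hom_add[OF that(2), of f f'] by simp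
  next
    case (smult a f)
    then show ?case
      using module_hom_smult[OF that(1), of a f] module_hom_smult[OF that(2), of a f] by simp
  qed (rule that(3))
  have word: "h (?e u \<otimes>\<^bsub>?F\<^esub> ?e v) = h (?e u) \<otimes>\<^bsub>B\<^esub> h (?e v)" if "u \<in> lists S" "v \<in> lists S" for u v
    using that B.word_prod_append[OF b that]
    by (simp add: free_algebra_mult_word[OF K] unit)
  have word_left: "h (?e u \<otimes>\<^bsub>?F\<^esub> g) = h (?e u) \<otimes>\<^bsub>B\<^esub> h g" if "u \<in> lists S" "g \<in> carrier ?F" for u g
    by (rule eqI[OF module_hom_comp[OF bilinear_mapD(1)[OF Fm(1) e[OF that(1)]] hom]
          module_hom_comp[OF hom bilinear_mapD(1)[OF Fm(2) module_hom_in_carrier[OF hom e[OF that(1)]]]]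
          word[OF that(1)] that(2)])
  have mult: "h (f \<otimes>\<^bsub>?F\<^esub> g) = h f \<otimes>\<^bsub>B\<^esub> h g" if "f \<in> carrier ?F" "g \<in> carrier ?F" for f g
    by (rule eqI[OF module_hom_comp[OF bilinear_mapD(2)[OF Fm(1) that(2)] hom]
          module_hom_comp[OF hom bilinear_mapD(2)[OF Fm(2) module_hom_in_carrier[OF hom that(2)]]]
          word_left[OF _ that(2)] that(1)])
  show "h \<in> algebra_hom K ?F B"
    by (rule algebra_homI[OF hom]) (simp_all add: mult unit word_prod_def)
  show "h (?e [p]) = b p" if "p \<in> S"
    using that b by (simp add: unit word_prod_def)
qed

section \<open>The FRT algebra\<close>

definition frt_relations_hold ::
  "('k, 'c) ring_scheme \<Rightarrow> nat \<Rightarrow> (nat \<Rightarrow> nat \<Rightarrow> nat \<Rightarrow> nat \<Rightarrow> 'k) \<Rightarrow> ('k, 'b, 'd) module_scheme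
    \<Rightarrow> (nat \<Rightarrow> nat \<Rightarrow> 'b) \<Rightarrow> bool" where
  "frt_relations_hold K N c B b \<longleftrightarrow>
    (\<forall>i\<in>{1..N}. \<forall>j\<in>{1..N}. \<forall>m\<in>{1..N}. \<forall>n\<in>{1..N}.
       (\<Oplus>\<^bsub>B\<^esub>k\<in>{1..N}. \<Oplus>\<^bsub>B\<^esub>l\<in>{1..N}. c i j k l \<odot>\<^bsub>B\<^esub> (b k m \<otimes>\<^bsub>B\<^esub> b l n)) =
       (\<Oplus>\<^bsub>B\<^esub>k\<in>{1..N}. \<Oplus>\<^bsub>B\<^esub>l\<in>{1..N}. c k l m n \<odot>\<^bsub>B\<^esub> (b i k \<otimes>\<^bsub>B\<^esub> b j l)))"

lemma algebra_hom_double_sum: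
  assumes A: "unital_algebra K A" and B: "unital_algebra K B" and h: "h \<in> algebra_hom K A B"
    and x: "\<And>k l. k \<in> I \<Longrightarrow> l \<in> J \<Longrightarrow> x k l \<in> carrier K"
    and p: "\<And>k l. k \<in> I \<Longrightarrow> l \<in> J \<Longrightarrow> p k l \<in> carrier A"
    and q: "\<And>k l. k \<in> I \<Longrightarrow> l \<in> J \<Longrightarrow> q k l \<in> carrier A"
  shows "h (\<Oplus>\<^bsub>A\<^esub>k\<in>I. \<Oplus>\<^bsub>A\<^esub>l\<in>J. x k l \<odot>\<^bsub>A\<^esub> (p k l \<otimes>\<^bsub>A\<^esub> q k l)) =
    (\<Oplus>\<^bsub>B\<^esub>k\<in>I. \<Oplus>\<^bsub>B\<^esub>l\<in>J. x k l \<odot>\<^bsub>B\<^esub> (h (p k l) \<otimes>\<^bsub>B\<^esub> h (q k l)))"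
proof -
  have MA: "module K A" and MB: "module K B"
    using A B by (simp_all add: unital_algebra_def)
  interpret A: module K A by fact
  interpret B: module K B by fact
  note hom = algebra_homD(1)[OF h]
  note sum = module_hom_finsum[OF MA MB hom]
  have t: "x k l \<odot>\<^bsub>A\<^esub> (p k l \<otimes>\<^bsub>A\<^esub> q k l) \<in> carrier A" if "k \<in> I" "l \<in> J" for k l
    using that by (intro A.smult_closed unital_algebra_carrier[OF A] x p q)
  have ht: "x k l \<odot>\<^bsub>B\<^esub> (h (p k l) \<otimes>\<^bsub>B\<^esub> h (q k l)) \<in> carrier B" if "k \<in> I" "l \<in> J" for k l
    using that by (intro B.smult_closed unital_algebra_carrier[OF B] x module_hom_in_carrier[OF hom] p q)
  have inner: "h (\<Oplus>\<^bsub>A\<^esub>l\<in>J. x k l \<odot>\<^bsub>A\<^esub> (p k l \<otimes>\<^bsub>A\<^esub> q k l)) =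
      (\<Oplus>\<^bsub>B\<^esub>l\<in>J. x k l \<odot>\<^bsub>B\<^esub> (h (p k l) \<otimes>\<^bsub>B\<^esub> h (q k l)))" if "k \<in> I" for k
  proof -
    have "h (\<Oplus>\<^bsub>A\<^esub>l\<in>J. x k l \<odot>\<^bsub>A\<^esub> (p k l \<otimes>\<^bsub>A\<^esub> q k l)) =
        (\<Oplus>\<^bsub>B\<^esub>l\<in>J. h (x k l \<odot>\<^bsub>A\<^esub> (p k l \<otimes>\<^bsub>A\<^esub> q k l)))"
      using t[OF that] by (intro sum) blast
    also have "\<dots> = (\<Oplus>\<^bsub>B\<^esub>l\<in>J. x k l \<odot>\<^bsub>B\<^esub> (h (p k l) \<otimes>\<^bsub>B\<^esub> h (q k l)))"
      using ht[OF that] x[OF that] p[OF that] q[OF that]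
      by (intro B.M.finsum_cong')
        (auto simp: module_hom_smult[OF hom] unital_algebra_carrier[OF A] algebra_homD(3)[OF h])
    finally show ?thesis .
  qed
  have "h (\<Oplus>\<^bsub>A\<^esub>k\<in>I. \<Oplus>\<^bsub>A\<^esub>l\<in>J. x k l \<odot>\<^bsub>A\<^esub> (p k l \<otimes>\<^bsub>A\<^esub> q k l)) =
      (\<Oplus>\<^bsub>B\<^esub>k\<in>I. h (\<Oplus>\<^bsub>A\<^esub>l\<in>J. x k l \<odot>\<^bsub>A\<^esub> (p k l \<otimes>\<^bsub>A\<^esub> q k l)))"
    using t by (intro sum) (auto intro!: A.M.finsum_closed)
  also have "\<dots> = (\<Oplus>\<^bsub>B\<^esub>k\<in>I. \<Oplus>\<^bsub>B\<^esub>l\<in>J. x k l \<odot>\<^bsub>B\<^esub> (h (p k l) \<otimes>\<^bsub>B\<^esub> h (q k l)))"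
    using ht by (intro B.M.finsum_cong') (auto simp: inner intro!: B.M.finsum_closed)
  finally show ?thesis .
qed

locale frt_algebra =
  fixes K :: "('k, 'c) ring_scheme" and N :: nat and c :: "nat \<Rightarrow> nat \<Rightarrow> nat \<Rightarrow> nat \<Rightarrow> 'k"
  assumes cring: "cring K"
    and coeff_closed: "\<lbrakk>i \<in> {1..N}; j \<in> {1..N}; m \<in> {1..N}; n \<in> {1..N}\<rbrakk> \<Longrightarrow> c i j m n \<in> carrier K"
begin

abbreviation "F \<equiv> frt_free K N"
abbreviation "X \<equiv> frt_var K"
abbreviation "A \<equiv> frt K N c"
abbreviation "T \<equiv> frt_gen K N c"
abbreviation "frt_coset x \<equiv> frt_ideal K N c +>\<^bsub>F\<^esub> x"

lemma F_algebra: "unital_algebra K F"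
  unfolding frt_free_def by (rule free_algebra_unital_algebra[OF cring])

lemma F_module: "module K F" and F_ring: "ring F"
  using F_algebra by (simp_all add: unital_algebra_def)

lemma X_closed: "i \<in> {1..N} \<Longrightarrow> j \<in> {1..N} \<Longrightarrow> X i j \<in> carrier F"
  unfolding frt_free_def frt_var_def using unit_vec_at_closed[OF cring, of "[(i, j)]"] by simp

lemma double_sum_closed:
  assumes B: "unital_algebra K B"
    and "\<And>k l. k \<in> I \<Longrightarrow> l \<in> J \<Longrightarrow> x k l \<in> carrier K"
    and "\<And>k l. k \<in> I \<Longrightarrow> l \<in> J \<Longrightarrow> p k l \<in> carrier B"
    and "\<And>k l. k \<in> I \<Longrightarrow> l \<in> J \<Longrightarrow> q k l \<in> carrier B"
  shows "(\<Oplus>\<^bsub>B\<^esub>k\<in>I. \<Oplus>\<^bsub>B\<^esub>l\<in>J. x k l \<odot>\<^bsub>B\<^esub> (p k l \<otimes>\<^bsub>B\<^esub> q k l)) \<in> carrier B"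
proof -
  interpret B: module K B
    using B by (simp add: unital_algebra_def)
  show ?thesis
    using assms by (auto intro!: B.M.finsum_closed unital_algebra_carrier[OF B])
qed

lemma relators_closed: "frt_relators K N c \<subseteq> carrier F"
proof -
  interpret F: module K F by (rule F_module)
  show ?thesis
    unfolding frt_relators_def Let_def
    by (auto intro!: F.M.minus_closed double_sum_closed F_algebra coeff_closed X_closed)
qed

text \<open>
  An algebra morphism sends a relator to the difference of the two sides of the relation for the
  images of the variables. This is used in both directions: for the projection onto the FRT algebra
  and for the construction of morphisms out of it.
\<close>

lemma relators_in_kernel_iff:
  assumes B: "unital_algebra K B" and h: "h \<in> algebra_hom K F B"
  shows "(\<forall>r\<in>frt_relators K N c. h r = \<zero>\<^bsub>B\<^esub>) \<longleftrightarrow> frt_relations_hold K N c B (\<lambda>i j. h (X i j))"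
proof -
  interpret B: module K B
    using B by (simp add: unital_algebra_def)
  interpret h: mod_hom K F B h
    using F_module B.module_axioms algebra_homD(1)[OF h] by (simp add: mod_hom_def mod_hom_axioms_def)
  let ?I = "{1..N}"
  let ?L = "\<lambda>i j m n. \<Oplus>\<^bsub>F\<^esub>k\<in>?I. \<Oplus>\<^bsub>F\<^esub>l\<in>?I. c i j k l \<odot>\<^bsub>F\<^esub> (X k m \<otimes>\<^bsub>F\<^esub> X l n)"
  let ?R = "\<lambda>i j m n. \<Oplus>\<^bsub>F\<^esub>k\<in>?I. \<Oplus>\<^bsub>F\<^esub>l\<in>?I. c k l m n \<odot>\<^bsub>F\<^esub> (X i k \<otimes>\<^bsub>F\<^esub> X j l)"
  let ?hX = "\<lambda>i j. h (X i j)"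
  have "h (?L i j m n \<ominus>\<^bsub>F\<^esub> ?R i j m n) = \<zero>\<^bsub>B\<^esub> \<longleftrightarrow>
      (\<Oplus>\<^bsub>B\<^esub>k\<in>?I. \<Oplus>\<^bsub>B\<^esub>l\<in>?I. c i j k l \<odot>\<^bsub>B\<^esub> (?hX k m \<otimes>\<^bsub>B\<^esub> ?hX l n)) =
      (\<Oplus>\<^bsub>B\<^esub>k\<in>?I. \<Oplus>\<^bsub>B\<^esub>l\<in>?I. c k l m n \<odot>\<^bsub>B\<^esub> (?hX i k \<otimes>\<^bsub>B\<^esub> ?hX j l))"
    if "i \<in> ?I" "j \<in> ?I" "m \<in> ?I" "n \<in> ?I" for i j m n
  proof -
    have L: "?L i j m n \<in> carrier F" and R: "?R i j m n \<in> carrier F"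
      by (rule double_sum_closed[OF F_algebra]; use that in \<open>simp add: coeff_closed X_closed\<close>)+
    have hL: "h (?L i j m n) = (\<Oplus>\<^bsub>B\<^esub>k\<in>?I. \<Oplus>\<^bsub>B\<^esub>l\<in>?I. c i j k l \<odot>\<^bsub>B\<^esub> (?hX k m \<otimes>\<^bsub>B\<^esub> ?hX l n))"
      using that by (intro algebra_hom_double_sum[OF F_algebra B h] coeff_closed X_closed)
    have hR: "h (?R i j m n) = (\<Oplus>\<^bsub>B\<^esub>k\<in>?I. \<Oplus>\<^bsub>B\<^esub>l\<in>?I. c k l m n \<odot>\<^bsub>B\<^esub> (?hX i k \<otimes>\<^bsub>B\<^esub> ?hX j l))"
      using that by (intro algebra_hom_double_sum[OF F_algebra B h] coeff_closed X_closed)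
    have "h (?L i j m n \<ominus>\<^bsub>F\<^esub> ?R i j m n) = h (?L i j m n) \<ominus>\<^bsub>B\<^esub> h (?R i j m n)"
      by (rule h.f_minus[OF L R])
    then show ?thesis
      using B.M.minus_other_side[OF h.f_im[OF L] h.f_im[OF R]] by (simp only: hL hR)
  qed
  then show ?thesis
    unfolding frt_relators_def frt_relations_hold_def Let_def by blast
qed

lemma frt_ideal_ideal: "ideal (frt_ideal K N c) F"
  unfolding frt_ideal_def by (rule ring.genideal_ideal[OF F_ring relators_closed])

lemma A_algebra: "unital_algebra K A"
  and frt_coset_hom: "(\<lambda>x. frt_coset x) \<in> algebra_hom K F A"
  unfolding frt_def by (rule quotient_algebra[OF F_algebra frt_ideal_ideal])+

lemma A_module: "module K A" and A_ring: "ring A"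
  using A_algebra by (simp_all add: unital_algebra_def)

lemma carrier_A: "carrier A = (\<lambda>x. frt_coset x) ` carrier F"
  unfolding frt_def
  by (rule quotient_module.carrier_quot[OF ideal_quotient_module[OF F_algebra frt_ideal_ideal]])

lemma T_closed: "i \<in> {1..N} \<Longrightarrow> j \<in> {1..N} \<Longrightarrow> T i j \<in> carrier A"
  unfolding frt_gen_def carrier_A by (rule imageI) (rule X_closed)

lemma one_A_closed: "\<one>\<^bsub>A\<^esub> \<in> carrier A"
  by (rule ring.ring_simprules(6)[OF A_ring])

lemma A_relations: "frt_relations_hold K N c A T"
proof -
  interpret Q: quotient_module K F "frt_ideal K N c"
    by (rule ideal_quotient_module[OF F_algebra frt_ideal_ideal])
  have "frt_relators K N c \<subseteq> frt_ideal K N c"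
    unfolding frt_ideal_def by (rule ring.genideal_self[OF F_ring relators_closed])
  then have "frt_coset r = \<zero>\<^bsub>A\<^esub>" if "r \<in> frt_relators K N c" for r
    using that Q.H.a_rcos_const[of r] by (auto simp: frt_def quot_module_def FactRing_def)
  then show ?thesis
    using relators_in_kernel_iff[OF A_algebra frt_coset_hom] unfolding frt_gen_def by blast
qed

text \<open>
  The universal property of the FRT algebra. The morphism on the free algebra given by \<open>b\<close> kills the
  relators; its kernel is an ideal, hence contains the ideal that they generate.
\<close>

lemma frt_lift:
  assumes B: "unital_algebra K B"
    and b: "\<And>i j. i \<in> {1..N} \<Longrightarrow> j \<in> {1..N} \<Longrightarrow> b i j \<in> carrier B"
    and rel: "frt_relations_hold K N c B b"
  obtains h where "h \<in> algebra_hom K A B"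
    and "\<And>i j. i \<in> {1..N} \<Longrightarrow> j \<in> {1..N} \<Longrightarrow> h (T i j) = b i j"
proof -
  let ?b = "\<lambda>p. b (fst p) (snd p)" and ?S = "{1..N} \<times> {1..N}"
  define g where "g = linear_extension K B (word_prod B ?b)"
  have b': "?b p \<in> carrier B" if "p \<in> ?S" for p
    using that b by auto
  have g: "g \<in> algebra_hom K F B"
    unfolding g_def frt_free_def by (rule free_algebra_lift(1)[OF B b'])
  have gX: "g (X i j) = b i j" if "i \<in> {1..N}" "j \<in> {1..N}" for i j
    unfolding g_def frt_var_def using free_algebra_lift(2)[OF B b', where p = "(i, j)"] that by simp
  have M: "module K B"
    using B by (simp add: unital_algebra_def)
  interpret B: module K B by fact
  note g_hom = algebra_homD(1)[OF g]
  have "frt_relations_hold K N c B (\<lambda>i j. g (X i j))"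
    unfolding frt_relations_hold_def
  proof (intro ballI, goal_cases)
    case (1 i j m n)
    have closed: "b i j \<otimes>\<^bsub>B\<^esub> b k l \<in> carrier B"
      if "i \<in> {1..N}" "j \<in> {1..N}" "k \<in> {1..N}" "l \<in> {1..N}" for i j k l
      using that by (intro unital_algebra_carrier[OF B] b)
    have "(\<Oplus>\<^bsub>B\<^esub>k\<in>{1..N}. \<Oplus>\<^bsub>B\<^esub>l\<in>{1..N}. c i j k l \<odot>\<^bsub>B\<^esub> (g (X k m) \<otimes>\<^bsub>B\<^esub> g (X l n))) =
        (\<Oplus>\<^bsub>B\<^esub>k\<in>{1..N}. \<Oplus>\<^bsub>B\<^esub>l\<in>{1..N}. c i j k l \<odot>\<^bsub>B\<^esub> (b k m \<otimes>\<^bsub>B\<^esub> b l n))"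
      using 1 by (intro B.M.finsum_cong') (auto simp: gX intro!: B.M.finsum_closed closed coeff_closed)
    moreover have "(\<Oplus>\<^bsub>B\<^esub>k\<in>{1..N}. \<Oplus>\<^bsub>B\<^esub>l\<in>{1..N}. c k l m n \<odot>\<^bsub>B\<^esub> (g (X i k) \<otimes>\<^bsub>B\<^esub> g (X j l))) =
        (\<Oplus>\<^bsub>B\<^esub>k\<in>{1..N}. \<Oplus>\<^bsub>B\<^esub>l\<in>{1..N}. c k l m n \<odot>\<^bsub>B\<^esub> (b i k \<otimes>\<^bsub>B\<^esub> b j l))"
      using 1 by (intro B.M.finsum_cong') (auto simp: gX intro!: B.M.finsum_closed closed coeff_closed)
    ultimately show ?case
      using rel 1 by (simp add: frt_relations_hold_def)
  qed
  then have "\<forall>r\<in>frt_relators K N c. g r = \<zero>\<^bsub>B\<^esub>"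
    by (simp add: relators_in_kernel_iff[OF B g])
  then have "frt_ideal K N c \<subseteq> {x \<in> carrier F. g x = \<zero>\<^bsub>B\<^esub>}"
    unfolding frt_ideal_def
    using relators_closed
    by (intro ring.genideal_minimal[OF F_ring algebra_hom_kernel_ideal[OF F_algebra B g]]) auto
  then have ker: "g x = \<zero>\<^bsub>B\<^esub>" if "x \<in> frt_ideal K N c" for x
    using that by auto
  interpret Q: quotient_module K F "frt_ideal K N c"
    by (rule ideal_quotient_module[OF F_algebra frt_ideal_ideal])
  let ?h = "\<lambda>Y. the_elem (g ` Y)"
  have h: "?h (frt_coset x) = g x" if "x \<in> carrier F" for x
    by (rule Q.the_elem_image_coset[OF M g_hom ker that])
  have "?h \<in> algebra_hom K A B"
  proof (rule algebra_homI)
    show "?h \<in> module_hom K A B"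
      unfolding frt_def by (rule Q.quot_hom[OF M g_hom ker])
    show "?h \<one>\<^bsub>A\<^esub> = \<one>\<^bsub>B\<^esub>"
      using h[OF ring.ring_simprules(6)[OF F_ring]] algebra_homD(2)[OF frt_coset_hom]
        algebra_homD(2)[OF g] by simp
    fix Y Z assume "Y \<in> carrier A" "Z \<in> carrier A"
    then obtain y z where "y \<in> carrier F" "z \<in> carrier F" "Y = frt_coset y" "Z = frt_coset z"
      by (auto simp: carrier_A)
    then show "?h (Y \<otimes>\<^bsub>A\<^esub> Z) = ?h Y \<otimes>\<^bsub>B\<^esub> ?h Z"
      by (simp add: h algebra_homD(3)[OF g] unital_algebra_carrier[OF F_algebra]
          flip: algebra_homD(3)[OF frt_coset_hom])
  qed
  moreover have "?h (T i j) = b i j" if "i \<in> {1..N}" "j \<in> {1..N}" for i j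
    unfolding frt_gen_def using h[OF X_closed[OF that]] gX[OF that] by simp
  ultimately show thesis
    by (rule that)
qed

text \<open>
  The basis words of the free algebra are products of variables, so the cosets of words are products
  of the \<open>T i j\<close>.
\<close>

lemma frt_induct [consumes 1, case_names one gen add smult mult]:
  assumes x: "x \<in> carrier A"
    and one: "P \<one>\<^bsub>A\<^esub>"
    and gen: "\<And>i j. \<lbrakk>i \<in> {1..N}; j \<in> {1..N}\<rbrakk> \<Longrightarrow> P (T i j)"
    and add: "\<And>x y. \<lbrakk>x \<in> carrier A; y \<in> carrier A; P x; P y\<rbrakk> \<Longrightarrow> P (x \<oplus>\<^bsub>A\<^esub> y)"
    and smult: "\<And>a x. \<lbrakk>a \<in> carrier K; x \<in> carrier A; P x\<rbrakk> \<Longrightarrow> P (a \<odot>\<^bsub>A\<^esub> x)"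
    and mult: "\<And>x y. \<lbrakk>x \<in> carrier A; y \<in> carrier A; P x; P y\<rbrakk> \<Longrightarrow> P (x \<otimes>\<^bsub>A\<^esub> y)"
  shows "P x"
proof -
  interpret K: cring K by (rule cring)
  let ?S = "{1..N} \<times> {1..N}"
  note hom = algebra_homD(1)[OF frt_coset_hom]
  have F: "carrier F = carrier (free_module K (lists ?S))"
    by (simp add: frt_free_def)
  have P0: "P \<zero>\<^bsub>A\<^esub>"
    using smult[OF K.zero_closed one_A_closed one] module.lmult_0[OF A_module one_A_closed] by simp
  obtain f where f: "f \<in> carrier F" "x = frt_coset f"
    using x by (auto simp: carrier_A)
  have "P (frt_coset f)"
    using cring f(1)[unfolded F]
  proof (induction rule: free_module_induct)
    case zero
    then show ?case
      using P0 module_hom_zero[OF F_module A_module hom] by (simp add: frt_free_def)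
  next
    case (unit w)
    then show ?case
    proof induction
      case Nil
      then show ?case
        using one algebra_homD(2)[OF frt_coset_hom] by (simp add: frt_free_def)
    next
      case (Cons p w)
      obtain i j where p: "p = (i, j)" "i \<in> {1..N}" "j \<in> {1..N}"
        using Cons.hyps(1) by auto
      have w: "unit_vec_at K w \<in> carrier F"
        unfolding F using unit_vec_at_closed[OF cring] Cons.hyps(2) .
      have "unit_vec_at K (p # w) = X i j \<otimes>\<^bsub>F\<^esub> unit_vec_at K w"
        using free_algebra_mult_word[OF cring, where u = "[p]" and v = w and S = ?S] by (simp add: p(1) frt_var_def frt_free_def)
      then have "frt_coset (unit_vec_at K (p # w)) = T i j \<otimes>\<^bsub>A\<^esub> frt_coset (unit_vec_at K w)"
        using algebra_homD(3)[OF frt_coset_hom X_closed[OF p(2,3)] w] by (simp add: frt_gen_def)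
      then show ?case
        using mult[OF T_closed[OF p(2,3)] module_hom_in_carrier[OF hom w] gen[OF p(2,3)] Cons.IH] by simp
    qed
  next
    case (add f g)
    then have "f \<in> carrier F" "g \<in> carrier F"
      by (simp_all add: F)
    then show ?case
      using assms(4)[OF _ _ add.IH] module_hom_add[OF hom, of f g] module_hom_in_carrier[OF hom]
      by (simp add: frt_free_def)
  next
    case (smult a f)
    then have "f \<in> carrier F"
      by (simp add: F)
    then show ?case
      using assms(5)[OF _ _ smult.IH] smult.hyps module_hom_smult[OF hom, of a f]
        module_hom_in_carrier[OF hom]
      by (simp add: frt_free_def)
  qed
  then show ?thesis
    using f(2) by simp
qed

lemma algebra_hom_eqI:
  assumes g: "g \<in> algebra_hom K A B" and h: "h \<in> algebra_hom K A B"
    and eq: "\<And>i j. i \<in> {1..N} \<Longrightarrow> j \<in> {1..N} \<Longrightarrow> g (T i j) = h (T i j)"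
    and x: "x \<in> carrier A"
  shows "g x = h x"
  using x
proof (induction rule: frt_induct)
  case one
  then show ?case
    using algebra_homD(2)[OF g] algebra_homD(2)[OF h] by simp
next
  case (add x y)
  then show ?case
    using algebra_homD(1)[OF g, THEN module_hom_add] algebra_homD(1)[OF h, THEN module_hom_add] by simp
next
  case (smult a x)
  then show ?case
    using algebra_homD(1)[OF g, THEN module_hom_smult] algebra_homD(1)[OF h, THEN module_hom_smult]
    by simp
next
  case (mult x y)
  then show ?case
    using algebra_homD(3)[OF g] algebra_homD(3)[OF h] by simp
qed (rule eq)

end

section \<open>Rescaling the generators\<close>

lemma (in cring) Units_ratio_mult:
  assumes u: "u \<in> Units R" and v: "v \<in> Units R" and w: "w \<in> Units R"
  shows "(u \<otimes> inv v) \<otimes> (v \<otimes> inv w) = u \<otimes> inv w"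
proof -
  have [simp]: "u \<in> carrier R" "v \<in> carrier R" "inv v \<in> carrier R" "inv w \<in> carrier R"
    using u v w by auto
  have "(u \<otimes> inv v) \<otimes> (v \<otimes> inv w) = (v \<otimes> inv v) \<otimes> (u \<otimes> inv w)"
    by (simp add: m_ac)
  then show ?thesis
    using v by simp
qed

lemma (in cring) Units_inv_mult_cong:
  assumes x: "x \<in> Units R" and y: "y \<in> Units R" and c: "c \<in> carrier R" and eq: "x \<otimes> c = y \<otimes> c"
  shows "inv x \<otimes> c = inv y \<otimes> c"
proof -
  have [simp]: "x \<in> carrier R" "y \<in> carrier R" "inv x \<in> carrier R" "inv y \<in> carrier R"
    using x y by auto
  have "inv x \<otimes> c = (y \<otimes> inv y) \<otimes> (inv x \<otimes> c)"
    using y c by simp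
  also have "\<dots> = (inv x \<otimes> inv y) \<otimes> (y \<otimes> c)"
    using c by (simp add: m_ac)
  also have "\<dots> = (inv x \<otimes> inv y) \<otimes> (x \<otimes> c)"
    by (simp only: eq)
  also have "\<dots> = (x \<otimes> inv x) \<otimes> (inv y \<otimes> c)"
    using c by (simp add: m_ac)
  also have "\<dots> = inv y \<otimes> c"
    using x c by simp
  finally show ?thesis .
qed

lemma (in cring) Units_inv_mult_distrib:
  assumes x: "x \<in> Units R" and y: "y \<in> Units R"
  shows "inv (x \<otimes> y) = inv x \<otimes> inv y"
proof -
  have [simp]: "x \<in> carrier R" "y \<in> carrier R" "inv x \<in> carrier R" "inv y \<in> carrier R"
    using x y by auto
  have "(x \<otimes> y) \<otimes> (inv x \<otimes> inv y) = (x \<otimes> inv x) \<otimes> (y \<otimes> inv y)"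
    by (simp add: m_ac)
  also have "\<dots> = \<one>"
    using x y by simp
  finally show ?thesis
    by (intro comm_inv_char) auto
qed

locale frt_scaling = frt_algebra K N c
  for K :: "('k, 'c) ring_scheme" and N :: nat and c :: "nat \<Rightarrow> nat \<Rightarrow> nat \<Rightarrow> nat \<Rightarrow> 'k" +
  fixes l :: "nat \<Rightarrow> 'k"
  assumes l_Units: "i \<in> {1..N} \<Longrightarrow> l i \<in> Units K"
    and l_coeff: "\<lbrakk>i \<in> {1..N}; j \<in> {1..N}; m \<in> {1..N}; n \<in> {1..N}\<rbrakk> \<Longrightarrow>
      l i \<otimes>\<^bsub>K\<^esub> l j \<otimes>\<^bsub>K\<^esub> c i j m n = l m \<otimes>\<^bsub>K\<^esub> l n \<otimes>\<^bsub>K\<^esub> c i j m n"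
begin

sublocale K: cring K
  by (rule cring)

abbreviation ratio :: "nat \<Rightarrow> nat \<Rightarrow> 'k" where
  "ratio i j \<equiv> l i \<otimes>\<^bsub>K\<^esub> inv\<^bsub>K\<^esub> (l j)"

lemma l_closed: "i \<in> {1..N} \<Longrightarrow> l i \<in> carrier K" "i \<in> {1..N} \<Longrightarrow> inv\<^bsub>K\<^esub> (l i) \<in> carrier K"
  using l_Units by auto

lemma ratio_closed: "i \<in> {1..N} \<Longrightarrow> j \<in> {1..N} \<Longrightarrow> ratio i j \<in> carrier K"
  by (simp add: l_closed)

lemma ratio_mult:
  "\<lbrakk>i \<in> {1..N}; k \<in> {1..N}; j \<in> {1..N}\<rbrakk> \<Longrightarrow> ratio i k \<otimes>\<^bsub>K\<^esub> ratio k j = ratio i j"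
  by (rule K.Units_ratio_mult[OF l_Units l_Units l_Units])

lemma ratio_self: "i \<in> {1..N} \<Longrightarrow> ratio i i = \<one>\<^bsub>K\<^esub>"
  using l_Units by simp

text \<open>
  In front of a coefficient \<open>c i j k p\<close> the products \<open>l i l j\<close> and \<open>l k l p\<close> may be exchanged, by the
  hypothesis on \<open>l\<close>. The first sum of the relations needs this in the numerators of the ratios, the
  second in their denominators.
\<close>

lemma ratio_coeff_upper:
  assumes "i \<in> {1..N}" "j \<in> {1..N}" "k \<in> {1..N}" "p \<in> {1..N}" "m \<in> {1..N}" "n \<in> {1..N}"
  shows "c i j k p \<otimes>\<^bsub>K\<^esub> (ratio k m \<otimes>\<^bsub>K\<^esub> ratio p n) = (ratio i m \<otimes>\<^bsub>K\<^esub> ratio j n) \<otimes>\<^bsub>K\<^esub> c i j k p"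
proof -
  note [simp] = l_closed[OF assms(1)] l_closed[OF assms(2)] l_closed[OF assms(3)]
    l_closed[OF assms(4)] l_closed[OF assms(5)] l_closed[OF assms(6)]
    coeff_closed[OF assms(1-4)]
  have "c i j k p \<otimes>\<^bsub>K\<^esub> (ratio k m \<otimes>\<^bsub>K\<^esub> ratio p n) =
      (l k \<otimes>\<^bsub>K\<^esub> l p \<otimes>\<^bsub>K\<^esub> c i j k p) \<otimes>\<^bsub>K\<^esub> (inv\<^bsub>K\<^esub> (l m) \<otimes>\<^bsub>K\<^esub> inv\<^bsub>K\<^esub> (l n))"
    by (simp add: K.m_ac)
  also have "\<dots> = (l i \<otimes>\<^bsub>K\<^esub> l j \<otimes>\<^bsub>K\<^esub> c i j k p) \<otimes>\<^bsub>K\<^esub> (inv\<^bsub>K\<^esub> (l m) \<otimes>\<^bsub>K\<^esub> inv\<^bsub>K\<^esub> (l n))"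
    using l_coeff[OF assms(1-4)] by simp
  also have "\<dots> = (ratio i m \<otimes>\<^bsub>K\<^esub> ratio j n) \<otimes>\<^bsub>K\<^esub> c i j k p"
    by (simp add: K.m_ac)
  finally show ?thesis .
qed

lemma ratio_coeff_lower:
  assumes "i \<in> {1..N}" "j \<in> {1..N}" "k \<in> {1..N}" "p \<in> {1..N}" "m \<in> {1..N}" "n \<in> {1..N}"
  shows "c k p m n \<otimes>\<^bsub>K\<^esub> (ratio i k \<otimes>\<^bsub>K\<^esub> ratio j p) = (ratio i m \<otimes>\<^bsub>K\<^esub> ratio j n) \<otimes>\<^bsub>K\<^esub> c k p m n"
proof -
  note [simp] = l_closed[OF assms(1)] l_closed[OF assms(2)] l_closed[OF assms(3)]
    l_closed[OF assms(4)] l_closed[OF assms(5)] l_closed[OF assms(6)]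
    coeff_closed[OF assms(3-6)]
  note kp = l_Units[OF assms(3)] l_Units[OF assms(4)] and mn = l_Units[OF assms(5)] l_Units[OF assms(6)]
  have "inv\<^bsub>K\<^esub> (l k \<otimes>\<^bsub>K\<^esub> l p) \<otimes>\<^bsub>K\<^esub> c k p m n = inv\<^bsub>K\<^esub> (l m \<otimes>\<^bsub>K\<^esub> l n) \<otimes>\<^bsub>K\<^esub> c k p m n"
    using kp mn l_coeff[OF assms(3-6)] by (intro K.Units_inv_mult_cong) auto
  then have inv: "(inv\<^bsub>K\<^esub> (l k) \<otimes>\<^bsub>K\<^esub> inv\<^bsub>K\<^esub> (l p)) \<otimes>\<^bsub>K\<^esub> c k p m n =
      (inv\<^bsub>K\<^esub> (l m) \<otimes>\<^bsub>K\<^esub> inv\<^bsub>K\<^esub> (l n)) \<otimes>\<^bsub>K\<^esub> c k p m n"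
    by (simp only: K.Units_inv_mult_distrib[OF kp] K.Units_inv_mult_distrib[OF mn])
  have "c k p m n \<otimes>\<^bsub>K\<^esub> (ratio i k \<otimes>\<^bsub>K\<^esub> ratio j p) =
      (l i \<otimes>\<^bsub>K\<^esub> l j) \<otimes>\<^bsub>K\<^esub> ((inv\<^bsub>K\<^esub> (l k) \<otimes>\<^bsub>K\<^esub> inv\<^bsub>K\<^esub> (l p)) \<otimes>\<^bsub>K\<^esub> c k p m n)"
    by (simp add: K.m_ac)
  also have "\<dots> = (ratio i m \<otimes>\<^bsub>K\<^esub> ratio j n) \<otimes>\<^bsub>K\<^esub> c k p m n"
    by (simp add: inv) (simp add: K.m_ac)
  finally show ?thesis .
qed

text \<open>
  By the exchange above, every summand on either side of the relation with indices \<open>i\<close>, \<open>j\<close>, \<open>m\<close>, \<open>n\<close>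
  acquires the factor \<open>ratio i m \<otimes> ratio j n\<close>, which depends on no summation index.
\<close>

lemma frt_relations_hold_scaled:
  assumes B: "unital_algebra K B"
    and b: "\<And>i j. i \<in> {1..N} \<Longrightarrow> j \<in> {1..N} \<Longrightarrow> b i j \<in> carrier B"
    and rel: "frt_relations_hold K N c B b"
  shows "frt_relations_hold K N c B (\<lambda>i j. ratio i j \<odot>\<^bsub>B\<^esub> b i j)"
  unfolding frt_relations_hold_def
proof (intro ballI)
  fix i j m n assume ijmn: "i \<in> {1..N}" "j \<in> {1..N}" "m \<in> {1..N}" "n \<in> {1..N}"
  interpret B: module K B
    using B by (simp add: unital_algebra_def)
  let ?s = "ratio i m \<otimes>\<^bsub>K\<^esub> ratio j n"
  have s: "?s \<in> carrier K"
    using ijmn by (intro K.m_closed ratio_closed)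
  have bb: "b i' j' \<otimes>\<^bsub>B\<^esub> b k' l' \<in> carrier B"
    if "i' \<in> {1..N}" "j' \<in> {1..N}" "k' \<in> {1..N}" "l' \<in> {1..N}" for i' j' k' l'
    using that by (intro unital_algebra_carrier[OF B] b)
  have pull: "(\<Oplus>\<^bsub>B\<^esub>k\<in>{1..N}. \<Oplus>\<^bsub>B\<^esub>p\<in>{1..N}. f k p) = ?s \<odot>\<^bsub>B\<^esub> (\<Oplus>\<^bsub>B\<^esub>k\<in>{1..N}. \<Oplus>\<^bsub>B\<^esub>p\<in>{1..N}. g k p)"
    if g: "\<And>k p. k \<in> {1..N} \<Longrightarrow> p \<in> {1..N} \<Longrightarrow> g k p \<in> carrier B"
      and f: "\<And>k p. k \<in> {1..N} \<Longrightarrow> p \<in> {1..N} \<Longrightarrow> f k p = ?s \<odot>\<^bsub>B\<^esub> g k p" for f g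
  proof -
    have "(\<Oplus>\<^bsub>B\<^esub>p\<in>{1..N}. f k p) = ?s \<odot>\<^bsub>B\<^esub> (\<Oplus>\<^bsub>B\<^esub>p\<in>{1..N}. g k p)" if k: "k \<in> {1..N}" for k
    proof -
      have "(\<Oplus>\<^bsub>B\<^esub>p\<in>{1..N}. f k p) = (\<Oplus>\<^bsub>B\<^esub>p\<in>{1..N}. ?s \<odot>\<^bsub>B\<^esub> g k p)"
        using f[OF k] g[OF k] s by (intro B.M.finsum_cong') auto
      then show ?thesis
        using B.finsum_smult[OF s, of "g k" "{1..N}"] g[OF k] by auto
    qed
    then have "(\<Oplus>\<^bsub>B\<^esub>k\<in>{1..N}. \<Oplus>\<^bsub>B\<^esub>p\<in>{1..N}. f k p) =
        (\<Oplus>\<^bsub>B\<^esub>k\<in>{1..N}. ?s \<odot>\<^bsub>B\<^esub> (\<Oplus>\<^bsub>B\<^esub>p\<in>{1..N}. g k p))"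
      using g s by (intro B.M.finsum_cong') (auto intro!: B.smult_closed B.M.finsum_closed)
    also have "\<dots> = ?s \<odot>\<^bsub>B\<^esub> (\<Oplus>\<^bsub>B\<^esub>k\<in>{1..N}. \<Oplus>\<^bsub>B\<^esub>p\<in>{1..N}. g k p)"
      using g s by (intro B.finsum_smult[symmetric]) (auto intro!: B.M.finsum_closed)
    finally show ?thesis .
  qed
  have upper: "c i j k p \<odot>\<^bsub>B\<^esub> ((ratio k m \<odot>\<^bsub>B\<^esub> b k m) \<otimes>\<^bsub>B\<^esub> (ratio p n \<odot>\<^bsub>B\<^esub> b p n)) =
      ?s \<odot>\<^bsub>B\<^esub> (c i j k p \<odot>\<^bsub>B\<^esub> (b k m \<otimes>\<^bsub>B\<^esub> b p n))" if "k \<in> {1..N}" "p \<in> {1..N}" for k p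
  proof -
    have "c i j k p \<odot>\<^bsub>B\<^esub> ((ratio k m \<odot>\<^bsub>B\<^esub> b k m) \<otimes>\<^bsub>B\<^esub> (ratio p n \<odot>\<^bsub>B\<^esub> b p n)) =
        (c i j k p \<otimes>\<^bsub>K\<^esub> (ratio k m \<otimes>\<^bsub>K\<^esub> ratio p n)) \<odot>\<^bsub>B\<^esub> (b k m \<otimes>\<^bsub>B\<^esub> b p n)"
      using that ijmn
      by (simp only: unital_algebra_smult_smult[OF B] ratio_closed b B.smult_assoc1 K.m_closed
          coeff_closed bb)
    then show ?thesis
      using that ijmn s by (simp only: ratio_coeff_upper B.smult_assoc1 coeff_closed bb)
  qed
  have lower: "c k p m n \<odot>\<^bsub>B\<^esub> ((ratio i k \<odot>\<^bsub>B\<^esub> b i k) \<otimes>\<^bsub>B\<^esub> (ratio j p \<odot>\<^bsub>B\<^esub> b j p)) =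
      ?s \<odot>\<^bsub>B\<^esub> (c k p m n \<odot>\<^bsub>B\<^esub> (b i k \<otimes>\<^bsub>B\<^esub> b j p))" if "k \<in> {1..N}" "p \<in> {1..N}" for k p
  proof -
    have "c k p m n \<odot>\<^bsub>B\<^esub> ((ratio i k \<odot>\<^bsub>B\<^esub> b i k) \<otimes>\<^bsub>B\<^esub> (ratio j p \<odot>\<^bsub>B\<^esub> b j p)) =
        (c k p m n \<otimes>\<^bsub>K\<^esub> (ratio i k \<otimes>\<^bsub>K\<^esub> ratio j p)) \<odot>\<^bsub>B\<^esub> (b i k \<otimes>\<^bsub>B\<^esub> b j p)"
      using that ijmn
      by (simp only: unital_algebra_smult_smult[OF B] ratio_closed b B.smult_assoc1 K.m_closed
          coeff_closed bb)
    then show ?thesis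
      using that ijmn s by (simp only: ratio_coeff_lower B.smult_assoc1 coeff_closed bb)
  qed
  have "(\<Oplus>\<^bsub>B\<^esub>k\<in>{1..N}. \<Oplus>\<^bsub>B\<^esub>p\<in>{1..N}. c i j k p \<odot>\<^bsub>B\<^esub> ((ratio k m \<odot>\<^bsub>B\<^esub> b k m) \<otimes>\<^bsub>B\<^esub> (ratio p n \<odot>\<^bsub>B\<^esub> b p n))) =
      ?s \<odot>\<^bsub>B\<^esub> (\<Oplus>\<^bsub>B\<^esub>k\<in>{1..N}. \<Oplus>\<^bsub>B\<^esub>p\<in>{1..N}. c i j k p \<odot>\<^bsub>B\<^esub> (b k m \<otimes>\<^bsub>B\<^esub> b p n))"
    using ijmn by (intro pull upper B.smult_closed coeff_closed bb)
  also have "\<dots> = ?s \<odot>\<^bsub>B\<^esub> (\<Oplus>\<^bsub>B\<^esub>k\<in>{1..N}. \<Oplus>\<^bsub>B\<^esub>p\<in>{1..N}. c k p m n \<odot>\<^bsub>B\<^esub> (b i k \<otimes>\<^bsub>B\<^esub> b j p))"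
    using rel ijmn by (simp add: frt_relations_hold_def)
  also have "\<dots> = (\<Oplus>\<^bsub>B\<^esub>k\<in>{1..N}. \<Oplus>\<^bsub>B\<^esub>p\<in>{1..N}. c k p m n \<odot>\<^bsub>B\<^esub> ((ratio i k \<odot>\<^bsub>B\<^esub> b i k) \<otimes>\<^bsub>B\<^esub> (ratio j p \<odot>\<^bsub>B\<^esub> b j p)))"
    using ijmn by (intro pull[symmetric] lower B.smult_closed coeff_closed bb)
  finally show "(\<Oplus>\<^bsub>B\<^esub>k\<in>{1..N}. \<Oplus>\<^bsub>B\<^esub>p\<in>{1..N}. c i j k p \<odot>\<^bsub>B\<^esub> ((ratio k m \<odot>\<^bsub>B\<^esub> b k m) \<otimes>\<^bsub>B\<^esub> (ratio p n \<odot>\<^bsub>B\<^esub> b p n))) =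
      (\<Oplus>\<^bsub>B\<^esub>k\<in>{1..N}. \<Oplus>\<^bsub>B\<^esub>p\<in>{1..N}. c k p m n \<odot>\<^bsub>B\<^esub> ((ratio i k \<odot>\<^bsub>B\<^esub> b i k) \<otimes>\<^bsub>B\<^esub> (ratio j p \<odot>\<^bsub>B\<^esub> b j p)))" .
qed

lemma scaling_endomorphism_exists:
  obtains \<alpha> where "\<alpha> \<in> algebra_hom K A A"
    and "\<And>i j. i \<in> {1..N} \<Longrightarrow> j \<in> {1..N} \<Longrightarrow> \<alpha> (T i j) = ratio i j \<odot>\<^bsub>A\<^esub> T i j"
proof -
  have "ratio i j \<odot>\<^bsub>A\<^esub> T i j \<in> carrier A" if "i \<in> {1..N}" "j \<in> {1..N}" for i j
    using that by (intro module.smult_closed[OF A_module] ratio_closed T_closed)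
  then show thesis
    using frt_lift[OF A_algebra _ frt_relations_hold_scaled[OF A_algebra T_closed A_relations]] that
    by blast
qed

end

locale frt_scaling_endomorphism = frt_scaling +
  fixes \<alpha> :: "((nat \<times> nat) list \<Rightarrow> 'a) set \<Rightarrow> ((nat \<times> nat) list \<Rightarrow> 'a) set"
  assumes \<alpha>: "\<alpha> \<in> algebra_hom K A A"
    and \<alpha>_gen: "\<And>i j. i \<in> {1..N} \<Longrightarrow> j \<in> {1..N} \<Longrightarrow> \<alpha> (T i j) = ratio i j \<odot>\<^bsub>A\<^esub> T i j"
begin

lemmas \<alpha>_hom = algebra_homD(1)[OF \<alpha>]
lemmas \<alpha>_closed = module_hom_in_carrier[OF \<alpha>_hom]

lemma \<alpha>\<alpha>_hom: "tensor_map K A A \<alpha> \<alpha> \<in> module_hom K (tensor K A A) (tensor K A A)"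
  by (rule tensor_map_hom[OF A_module A_module A_module A_module \<alpha>_hom \<alpha>_hom])

lemma \<alpha>\<alpha>_pure:
  "x \<in> carrier A \<Longrightarrow> y \<in> carrier A \<Longrightarrow>
    tensor_map K A A \<alpha> \<alpha> (pure_tensor K A A x y) = pure_tensor K A A (\<alpha> x) (\<alpha> y)"
  by (rule tensor_map_pure[OF A_module A_module A_module A_module \<alpha>_hom \<alpha>_hom])

text \<open>
  On a generator this is the cancellation \<open>ratio i k \<otimes> ratio k j = ratio i j\<close> of the inner index;
  both sides are multiplicative and linear.
\<close>

lemma comultiplication_scaling:
  assumes \<Delta>: "is_frt_comult K N c \<Delta>" and x: "x \<in> carrier A"
  shows "\<Delta> (\<alpha> x) = tensor_map K A A \<alpha> \<alpha> (\<Delta> x)"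
proof -
  let ?T2 = "tensor K A A" and ?t = "pure_tensor K A A" and ?\<alpha>\<alpha> = "tensor_map K A A \<alpha> \<alpha>"
  note T2 = tensor_is_module[OF A_module A_module]
  interpret T2: module K ?T2 by (rule T2)
  have \<Delta>_alg: "\<Delta> \<in> algebra_hom K A (tensor_algebra K A A)"
    and \<Delta>_gen: "\<And>i j. i \<in> {1..N} \<Longrightarrow> j \<in> {1..N} \<Longrightarrow>
      \<Delta> (T i j) = (\<Oplus>\<^bsub>?T2\<^esub>k\<in>{1..N}. ?t (T i k) (T k j))"
    using \<Delta> unfolding is_frt_comult_def Let_def by blast+
  have \<Delta>_hom: "\<Delta> \<in> module_hom K A ?T2"
    using algebra_homD(1)[OF \<Delta>_alg] by (simp add: module_hom_def)
  note \<Delta>_closed = module_hom_in_carrier[OF \<Delta>_hom]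
  show ?thesis
    using x
  proof (induction rule: frt_induct)
    case one
    then show ?case
      using algebra_homD(2)[OF \<alpha>] algebra_homD(2)[OF \<Delta>_alg] \<alpha>\<alpha>_pure one_A_closed by simp
  next
    case (gen i j)
    have t: "?t (T i k) (T k j) \<in> carrier ?T2" if "k \<in> {1..N}" for k
      using gen that by (intro pure_tensor_closed[OF A_module A_module] T_closed)
    have "\<Delta> (\<alpha> (T i j)) = ratio i j \<odot>\<^bsub>?T2\<^esub> (\<Oplus>\<^bsub>?T2\<^esub>k\<in>{1..N}. ?t (T i k) (T k j))"
      using gen by (simp only: \<alpha>_gen module_hom_smult[OF \<Delta>_hom] ratio_closed T_closed \<Delta>_gen)
    also have "\<dots> = (\<Oplus>\<^bsub>?T2\<^esub>k\<in>{1..N}. ratio i j \<odot>\<^bsub>?T2\<^esub> ?t (T i k) (T k j))"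
      using t gen by (intro T2.finsum_smult) (auto intro: ratio_closed)
    also have "\<dots> = (\<Oplus>\<^bsub>?T2\<^esub>k\<in>{1..N}. ?\<alpha>\<alpha> (?t (T i k) (T k j)))"
    proof (rule T2.M.finsum_cong')
      fix k assume k: "k \<in> {1..N}"
      then show "ratio i j \<odot>\<^bsub>?T2\<^esub> ?t (T i k) (T k j) = ?\<alpha>\<alpha> (?t (T i k) (T k j))"
        using gen
        by (simp only: \<alpha>\<alpha>_pure T_closed \<alpha>_gen ratio_closed
            pure_tensor_smult_smult[OF A_module A_module] ratio_mult)
    qed (use t module_hom_in_carrier[OF \<alpha>\<alpha>_hom] in auto)
    also have "\<dots> = ?\<alpha>\<alpha> (\<Oplus>\<^bsub>?T2\<^esub>k\<in>{1..N}. ?t (T i k) (T k j))"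
      using t by (intro module_hom_finsum[OF T2 T2 \<alpha>\<alpha>_hom, symmetric]) auto
    finally show ?case
      using gen by (simp only: \<Delta>_gen)
  next
    case (add x y)
    then show ?case
      by (simp add: module_hom_add[OF \<alpha>_hom] module_hom_add[OF \<Delta>_hom] module_hom_add[OF \<alpha>\<alpha>_hom]
          \<alpha>_closed \<Delta>_closed)
  next
    case (smult a x)
    then show ?case
      by (simp add: module_hom_smult[OF \<alpha>_hom] module_hom_smult[OF \<Delta>_hom] module_hom_smult[OF \<alpha>\<alpha>_hom]
          \<alpha>_closed \<Delta>_closed)
  next
    case (mult x y)
    then show ?case
      by (simp add: algebra_homD(3)[OF \<alpha>] algebra_homD(3)[OF \<Delta>_alg] \<alpha>_closed \<Delta>_closed
          tensor_map_mult[OF A_algebra A_algebra A_algebra A_algebra \<alpha> \<alpha>])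
  qed
qed

text \<open>The counit of \<open>T i j\<close> is nonzero only for \<open>i = j\<close>, where the ratio is \<open>1\<close>.\<close>

lemma counit_scaling:
  assumes \<epsilon>: "is_frt_counit K N c \<epsilon>" and x: "x \<in> carrier A"
  shows "\<epsilon> (\<alpha> x) = \<epsilon> x"
proof -
  have \<epsilon>_alg: "\<epsilon> \<in> algebra_hom K A (self_module K)"
    and \<epsilon>_gen: "\<And>i j. i \<in> {1..N} \<Longrightarrow> j \<in> {1..N} \<Longrightarrow> \<epsilon> (T i j) = (if i = j then \<one>\<^bsub>K\<^esub> else \<zero>\<^bsub>K\<^esub>)"
    using \<epsilon> unfolding is_frt_counit_def by blast+
  note \<epsilon>_hom = algebra_homD(1)[OF \<epsilon>_alg]
  have "(\<lambda>x. \<epsilon> (\<alpha> x)) \<in> algebra_hom K A (self_module K)"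
    using algebra_homD(2,3)[OF \<epsilon>_alg] algebra_homD(2,3)[OF \<alpha>] \<alpha>_closed
    by (intro algebra_homI module_hom_comp[OF \<alpha>_hom \<epsilon>_hom]) simp_all
  moreover have "\<epsilon> (\<alpha> (T i j)) = \<epsilon> (T i j)" if "i \<in> {1..N}" "j \<in> {1..N}" for i j
  proof -
    have "\<epsilon> (\<alpha> (T i j)) = ratio i j \<otimes>\<^bsub>K\<^esub> \<epsilon> (T i j)"
      using module_hom_smult[OF \<epsilon>_hom ratio_closed[OF that] T_closed[OF that]] \<alpha>_gen[OF that] by simp
    then show ?thesis
      using ratio_closed[OF that] ratio_self[OF that(1)] \<epsilon>_gen[OF that] by auto
  qed
  ultimately show ?thesis
    by (rule algebra_hom_eqI[OF _ \<epsilon>_alg _ x])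
qed

lemma scaling_bialgebra_hom:
  assumes "is_frt_comult K N c \<Delta>" "is_frt_counit K N c \<epsilon>"
  shows "\<alpha> \<in> bialgebra_hom K A \<Delta> \<epsilon> A \<Delta> \<epsilon>"
  unfolding bialgebra_hom_def
  using \<alpha> comultiplication_scaling[OF assms(1)] counit_scaling[OF assms(2)] by blast

text \<open>
  The form and its twist by \<open>\<alpha>\<close> agree on pairs taken from the unit and the generators, and they obey
  the same product rules in both arguments. This determines a form, but the rules have to be
  applied in a suitable order: the rule in the right argument splits the left argument by \<open>\<Delta>\<close>, which for the
  unit and the generators leads to tensors of such elements again. So the right argument is extended
  from generators to the whole algebra first, and the left argument afterwards.
\<close>

lemma form_scaling_pure:
  assumes \<Delta>: "is_frt_comult K N c \<Delta>" and R: "is_frt_form K N c \<Delta> R"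
    and x: "x \<in> carrier A" and z: "z \<in> carrier A"
  shows "R (pure_tensor K A A (\<alpha> x) (\<alpha> z)) = R (pure_tensor K A A x z)"
proof -
  let ?T2 = "tensor K A A" and ?t = "pure_tensor K A A" and ?K = "self_module K"
  let ?lift = "tensor_lift K ?K" and ?\<delta> = "\<lambda>i j. if i = j then \<one>\<^bsub>K\<^esub> else \<zero>\<^bsub>K\<^esub>"
  define r where "r x y = R (?t x y)" for x y
  note M = A_module A_module
  note T2 = tensor_is_module[OF M]
  interpret T2: module K ?T2 by (rule T2)
  note Km = self_module_is_module[OF cring]
  have \<Delta>_alg: "\<Delta> \<in> algebra_hom K A (tensor_algebra K A A)"
    and \<Delta>_gen: "\<And>i j. i \<in> {1..N} \<Longrightarrow> j \<in> {1..N} \<Longrightarrow>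
      \<Delta> (T i j) = (\<Oplus>\<^bsub>?T2\<^esub>k\<in>{1..N}. ?t (T i k) (T k j))"
    using \<Delta> unfolding is_frt_comult_def Let_def by blast+
  have \<Delta>_closed: "\<Delta> x \<in> carrier ?T2" if "x \<in> carrier A" for x
    using module_hom_in_carrier[OF algebra_homD(1)[OF \<Delta>_alg] that] by simp
  have R_hom: "R \<in> module_hom K ?T2 ?K"
    and r_gen: "\<And>i j m n. \<lbrakk>i \<in> {1..N}; j \<in> {1..N}; m \<in> {1..N}; n \<in> {1..N}\<rbrakk> \<Longrightarrow>
      r (T i m) (T j n) = c j i m n"
    and r_one: "\<And>i j. \<lbrakk>i \<in> {1..N}; j \<in> {1..N}\<rbrakk> \<Longrightarrow> r \<one>\<^bsub>A\<^esub> (T i j) = ?\<delta> i j"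
      "\<And>i j. \<lbrakk>i \<in> {1..N}; j \<in> {1..N}\<rbrakk> \<Longrightarrow> r (T i j) \<one>\<^bsub>A\<^esub> = ?\<delta> i j"
    and r_left: "\<And>x y z. \<lbrakk>x \<in> carrier A; y \<in> carrier A; z \<in> carrier A\<rbrakk> \<Longrightarrow>
      r (x \<otimes>\<^bsub>A\<^esub> y) z = ?lift (\<lambda>z1 z2. r x z1 \<otimes>\<^bsub>K\<^esub> r y z2) (\<Delta> z)"
    and r_right: "\<And>x y z. \<lbrakk>x \<in> carrier A; y \<in> carrier A; z \<in> carrier A\<rbrakk> \<Longrightarrow>
      r x (y \<otimes>\<^bsub>A\<^esub> z) = ?lift (\<lambda>x1 x2. r x1 z \<otimes>\<^bsub>K\<^esub> r x2 y) (\<Delta> x)"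
    using R unfolding is_frt_form_def Let_def r_def by blast+
  have r: "bilinear_map K A A ?K r"
    unfolding r_def by (rule module_hom_comp_bilinear[OF bilinear_pure_tensor[OF M] R_hom])
  note r1 = bilinear_mapD(1)[OF r] and r2 = bilinear_mapD(2)[OF r]
  note ra = bilinear_map_comp[OF r \<alpha>_hom \<alpha>_hom]
  note ra1 = bilinear_mapD(1)[OF ra] and ra2 = bilinear_mapD(2)[OF ra]
  have prod_left: "bilinear_map K A A ?K (\<lambda>z1 z2. r x z1 \<otimes>\<^bsub>K\<^esub> r y z2)"
    if "x \<in> carrier A" "y \<in> carrier A" for x y
    by (rule bilinear_map_mult[OF cring r1[OF that(1)] r1[OF that(2)]])
  have prod_right: "bilinear_map K A A ?K (\<lambda>x1 x2. r x1 z \<otimes>\<^bsub>K\<^esub> r x2 y)"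
    if "y \<in> carrier A" "z \<in> carrier A" for y z
    by (rule bilinear_map_mult[OF cring r2[OF that(2)] r2[OF that(1)]])
  (* The twisted form obeys the two product rules because \<alpha> is multiplicative and commutes with \<Delta>. *)
  have ra_left: "r (\<alpha> (x \<otimes>\<^bsub>A\<^esub> y)) (\<alpha> z) = ?lift (\<lambda>z1 z2. r (\<alpha> x) (\<alpha> z1) \<otimes>\<^bsub>K\<^esub> r (\<alpha> y) (\<alpha> z2)) (\<Delta> z)"
    if "x \<in> carrier A" "y \<in> carrier A" "z \<in> carrier A" for x y z
  proof -
    have "r (\<alpha> (x \<otimes>\<^bsub>A\<^esub> y)) (\<alpha> z) =
        ?lift (\<lambda>z1 z2. r (\<alpha> x) z1 \<otimes>\<^bsub>K\<^esub> r (\<alpha> y) z2) (tensor_map K A A \<alpha> \<alpha> (\<Delta> z))"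
      using that
      by (simp add: algebra_homD(3)[OF \<alpha>] r_left \<alpha>_closed comultiplication_scaling[OF \<Delta>])
    also have "\<dots> = ?lift (\<lambda>z1 z2. r (\<alpha> x) (\<alpha> z1) \<otimes>\<^bsub>K\<^esub> r (\<alpha> y) (\<alpha> z2)) (\<Delta> z)"
      using that
      by (intro tensor_lift_tensor_map[OF M M \<alpha>_hom \<alpha>_hom Km prod_left]) (simp_all add: \<alpha>_closed \<Delta>_closed)
    finally show ?thesis .
  qed
  have ra_right: "r (\<alpha> x) (\<alpha> (y \<otimes>\<^bsub>A\<^esub> z)) = ?lift (\<lambda>x1 x2. r (\<alpha> x1) (\<alpha> z) \<otimes>\<^bsub>K\<^esub> r (\<alpha> x2) (\<alpha> y)) (\<Delta> x)"
    if "x \<in> carrier A" "y \<in> carrier A" "z \<in> carrier A" for x y z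
  proof -
    have "r (\<alpha> x) (\<alpha> (y \<otimes>\<^bsub>A\<^esub> z)) =
        ?lift (\<lambda>x1 x2. r x1 (\<alpha> z) \<otimes>\<^bsub>K\<^esub> r x2 (\<alpha> y)) (tensor_map K A A \<alpha> \<alpha> (\<Delta> x))"
      using that
      by (simp add: algebra_homD(3)[OF \<alpha>] r_right \<alpha>_closed comultiplication_scaling[OF \<Delta>])
    also have "\<dots> = ?lift (\<lambda>x1 x2. r (\<alpha> x1) (\<alpha> z) \<otimes>\<^bsub>K\<^esub> r (\<alpha> x2) (\<alpha> y)) (\<Delta> x)"
      using that
      by (intro tensor_lift_tensor_map[OF M M \<alpha>_hom \<alpha>_hom Km prod_right]) (simp_all add: \<alpha>_closed \<Delta>_closed)
    finally show ?thesis .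
  qed
  have ra_prod_right: "bilinear_map K A A ?K (\<lambda>x1 x2. r (\<alpha> x1) (\<alpha> z) \<otimes>\<^bsub>K\<^esub> r (\<alpha> x2) (\<alpha> y))"
    if "y \<in> carrier A" "z \<in> carrier A" for y z
    by (rule bilinear_map_mult[OF cring ra2[OF that(2)] ra2[OF that(1)]])
  have ra_prod_left: "bilinear_map K A A ?K (\<lambda>z1 z2. r (\<alpha> x) (\<alpha> z1) \<otimes>\<^bsub>K\<^esub> r (\<alpha> y) (\<alpha> z2))"
    if "x \<in> carrier A" "y \<in> carrier A" for x y
    by (rule bilinear_map_mult[OF cring ra1[OF that(1)] ra1[OF that(2)]])
  have \<alpha>_one: "\<alpha> \<one>\<^bsub>A\<^esub> = \<one>\<^bsub>A\<^esub>"
    by (rule algebra_homD(2)[OF \<alpha>])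
  have \<Delta>_one: "\<Delta> \<one>\<^bsub>A\<^esub> = ?t \<one>\<^bsub>A\<^esub> \<one>\<^bsub>A\<^esub>"
    using algebra_homD(2)[OF \<Delta>_alg] by simp
  have ra_gen: "r (\<alpha> (T i j)) z = ratio i j \<otimes>\<^bsub>K\<^esub> r (T i j) z"
    "r z (\<alpha> (T i j)) = ratio i j \<otimes>\<^bsub>K\<^esub> r z (T i j)"
    if "i \<in> {1..N}" "j \<in> {1..N}" "z \<in> carrier A" for i j z
    using module_hom_smult[OF r2[OF that(3)] ratio_closed[OF that(1,2)] T_closed[OF that(1,2)]]
      module_hom_smult[OF r1[OF that(3)] ratio_closed[OF that(1,2)] T_closed[OF that(1,2)]]
    by (simp_all add: \<alpha>_gen[OF that(1,2)])
  have \<delta>_gen: "ratio i j \<otimes>\<^bsub>K\<^esub> ?\<delta> i j = ?\<delta> i j" if "i \<in> {1..N}" "j \<in> {1..N}" for i j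
    using that ratio_closed[OF that] ratio_self by auto
  have agree_add: "r (\<alpha> x) (\<alpha> (y \<oplus>\<^bsub>A\<^esub> z)) = r x (y \<oplus>\<^bsub>A\<^esub> z)"
    if "x \<in> carrier A" "y \<in> carrier A" "z \<in> carrier A"
      "r (\<alpha> x) (\<alpha> y) = r x y" "r (\<alpha> x) (\<alpha> z) = r x z" for x y z
    using that module_hom_add[OF ra1[OF that(1)] that(2,3)] module_hom_add[OF r1[OF that(1)] that(2,3)]
    by simp
  have agree_smult: "r (\<alpha> x) (\<alpha> (a \<odot>\<^bsub>A\<^esub> y)) = r x (a \<odot>\<^bsub>A\<^esub> y)"
    if "x \<in> carrier A" "a \<in> carrier K" "y \<in> carrier A" "r (\<alpha> x) (\<alpha> y) = r x y" for x a y
    using that module_hom_smult[OF ra1[OF that(1)] that(2,3)] module_hom_smult[OF r1[OF that(1)] that(2,3)]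
    by simp
  have base: "r (\<alpha> \<one>\<^bsub>A\<^esub>) (\<alpha> z) = r \<one>\<^bsub>A\<^esub> z \<and>
      (\<forall>i\<in>{1..N}. \<forall>j\<in>{1..N}. r (\<alpha> (T i j)) (\<alpha> z) = r (T i j) z)" if "z \<in> carrier A" for z
    using that
  proof (induction z rule: frt_induct)
    case one
    then show ?case
      by (simp add: \<alpha>_one ra_gen one_A_closed r_one \<delta>_gen)
  next
    case (gen j n)
    have "r (\<alpha> (T i m)) (\<alpha> (T j n)) = r (T i m) (T j n)" if im: "i \<in> {1..N}" "m \<in> {1..N}" for i m
    proof -
      note [simp] = l_closed[OF im(1)] l_closed[OF im(2)] l_closed[OF gen(1)] l_closed[OF gen(2)]
        coeff_closed[OF gen(1) im gen(2)]
      have "r (\<alpha> (T i m)) (\<alpha> (T j n)) = (ratio i m \<otimes>\<^bsub>K\<^esub> ratio j n) \<otimes>\<^bsub>K\<^esub> c j i m n"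
        using im gen
        by (simp add: ra_gen \<alpha>_closed T_closed r_gen K.m_ac)
      also have "\<dots> = (ratio j m \<otimes>\<^bsub>K\<^esub> ratio i n) \<otimes>\<^bsub>K\<^esub> c j i m n"
        by (simp add: K.m_ac)
      (* The exchange of upper and lower indices, with denominators m and n, turns the factor into
         a product of trivial ratios. *)
      also have "\<dots> = c j i m n \<otimes>\<^bsub>K\<^esub> (ratio m m \<otimes>\<^bsub>K\<^esub> ratio n n)"
        using im gen by (intro ratio_coeff_upper[symmetric]) auto
      also have "\<dots> = c j i m n"
        using im gen by (simp only: ratio_self K.r_one K.one_closed coeff_closed)
      finally show ?thesis
        using im gen by (simp add: r_gen)
    qed
    then show ?case
      using gen by (auto simp: \<alpha>_one ra_gen one_A_closed r_one \<delta>_gen)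
  next
    case (add y z)
    then show ?case
      using agree_add[of _ y z] one_A_closed T_closed by auto
  next
    case (smult a z)
    then show ?case
      using agree_smult[of _ a z] one_A_closed T_closed by auto
  next
    case (mult y z)
    let ?b = "\<lambda>x1 x2. r x1 z \<otimes>\<^bsub>K\<^esub> r x2 y"
      and ?b' = "\<lambda>x1 x2. r (\<alpha> x1) (\<alpha> z) \<otimes>\<^bsub>K\<^esub> r (\<alpha> x2) (\<alpha> y)"
    note b = prod_right[OF mult.hyps] and b' = ra_prod_right[OF mult.hyps]
    have lift: "?lift ?b' (?t x1 x2) = ?b' x1 x2" "?lift ?b (?t x1 x2) = ?b x1 x2"
      if "x1 \<in> carrier A" "x2 \<in> carrier A" for x1 x2
      by (rule tensor_lift_pure[OF M Km b' that] tensor_lift_pure[OF M Km b that])+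
    have "r (\<alpha> \<one>\<^bsub>A\<^esub>) (\<alpha> (y \<otimes>\<^bsub>A\<^esub> z)) = r \<one>\<^bsub>A\<^esub> (y \<otimes>\<^bsub>A\<^esub> z)"
      using mult by (simp add: ra_right r_right one_A_closed \<Delta>_one lift)
    moreover have "r (\<alpha> (T i j)) (\<alpha> (y \<otimes>\<^bsub>A\<^esub> z)) = r (T i j) (y \<otimes>\<^bsub>A\<^esub> z)"
      if ij: "i \<in> {1..N}" "j \<in> {1..N}" for i j
    proof -
      have tc: "(\<lambda>k. ?t (T i k) (T k j)) \<in> {1..N} \<rightarrow> carrier ?T2"
        using ij by (auto intro!: pure_tensor_closed[OF M] T_closed)
      note lift_sum = module_hom_finsum[OF T2 Km tensor_lift_hom[OF M Km b] tc]
        module_hom_finsum[OF T2 Km tensor_lift_hom[OF M Km b'] tc]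
      have "?lift ?b' (?t (T i k) (T k j)) = ?lift ?b (?t (T i k) (T k j))" if "k \<in> {1..N}" for k
        using mult.IH ij that by (simp add: lift T_closed)
      then have "(\<Oplus>\<^bsub>?K\<^esub>k\<in>{1..N}. ?lift ?b' (?t (T i k) (T k j))) =
          (\<Oplus>\<^bsub>?K\<^esub>k\<in>{1..N}. ?lift ?b (?t (T i k) (T k j)))"
        using tc module_hom_in_carrier[OF tensor_lift_hom[OF M Km b]]
        by (intro abelian_monoid.finsum_cong'[OF abelian_group.axioms(1)[OF module.axioms(2)[OF Km]]])
          auto
      then show ?thesis
        using ij mult.hyps by (simp only: ra_right r_right T_closed \<Delta>_gen lift_sum)
    qed
    ultimately show ?case
      by blast
  qed
  have "\<forall>z\<in>carrier A. r (\<alpha> x) (\<alpha> z) = r x z"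
    using x
  proof (induction x rule: frt_induct)
    case (add x y)
    then show ?case
      using module_hom_add[OF ra2 add.hyps] module_hom_add[OF r2 add.hyps] by simp
  next
    case (smult a x)
    then show ?case
      using module_hom_smult[OF ra2 smult.hyps] module_hom_smult[OF r2 smult.hyps] by simp
  next
    case (mult x y)
    then show ?case
      by (auto simp: ra_left r_left intro!: tensor_lift_cong[OF M Km ra_prod_left prod_left] \<Delta>_closed)
  qed (use base in auto)
  then show ?thesis
    using z by (simp add: r_def)
qed

lemma form_scaling:
  assumes \<Delta>: "is_frt_comult K N c \<Delta>" and R: "is_frt_form K N c \<Delta> R"
    and t: "t \<in> carrier (tensor K A A)"
  shows "R (tensor_map K A A \<alpha> \<alpha> t) = R t"
proof -
  have R_hom: "R \<in> module_hom K (tensor K A A) (self_module K)"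
    using R by (simp add: is_frt_form_def Let_def)
  show ?thesis
    by (rule tensor_hom_eqI[OF A_module A_module module_hom_comp[OF \<alpha>\<alpha>_hom R_hom] R_hom _ t])
      (simp add: \<alpha>\<alpha>_pure form_scaling_pure[OF \<Delta> R])
qed

end

section \<open>The rescaling on the comodule\<close>

theorem theorem4p3:
  fixes K :: "('k, 'c) ring_scheme"
    and V :: "('k, 'v, 'd) module_scheme"
    and N :: nat
    and v :: "nat \<Rightarrow> 'v"
    and \<gamma> :: "('v \<times> 'v \<Rightarrow> 'k) set \<Rightarrow> ('v \<times> 'v \<Rightarrow> 'k) set"
    and c :: "nat \<Rightarrow> nat \<Rightarrow> nat \<Rightarrow> nat \<Rightarrow> 'k"
    and l :: "nat \<Rightarrow> 'k"
  defines "A \<equiv> frt K N c"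
    and "T \<equiv> frt_gen K N c"
  assumes "field K"
    and char_0: "\<And>n :: nat. n > 0 \<Longrightarrow> [n] \<cdot>\<^bsub>K\<^esub> \<one>\<^bsub>K\<^esub> \<noteq> \<zero>\<^bsub>K\<^esub>"
    and "vectorspace K V"
    and "inj_on v {1..N}" and "vectorspace.basis K V (v ` {1..N})"
    and "R_matrix K V \<gamma>"
    and "is_structure_constants K V N v \<gamma> c"
    and "is_frt_comult K N c \<Delta>"
    and "is_frt_counit K N c \<epsilon>"
    and "is_frt_form K N c \<Delta> R"
    and "\<And>i. i \<in> {1..N} \<Longrightarrow> l i \<in> Units K"
    and "\<And>i j m n. \<lbrakk>i \<in> {1..N}; j \<in> {1..N}; m \<in> {1..N}; n \<in> {1..N}\<rbrakk> \<Longrightarrow>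
           l i \<otimes>\<^bsub>K\<^esub> l j \<otimes>\<^bsub>K\<^esub> c i j m n = l m \<otimes>\<^bsub>K\<^esub> l n \<otimes>\<^bsub>K\<^esub> c i j m n"
    and "\<alpha>\<^sub>V \<in> module_hom K V V" and "\<And>i. i \<in> {1..N} \<Longrightarrow> \<alpha>\<^sub>V (v i) = l i \<odot>\<^bsub>V\<^esub> v i"
    and "\<rho> \<in> module_hom K V (tensor K A V)"
    and "\<And>i. i \<in> {1..N} \<Longrightarrow> \<rho> (v i) = (\<Oplus>\<^bsub>tensor K A V\<^esub>k\<in>{1..N}. pure_tensor K A V (T i k) (v k))"
  shows "\<exists>\<alpha>\<^sub>A.
      (\<alpha>\<^sub>A \<in> bialgebra_hom K A \<Delta> \<epsilon> A \<Delta> \<epsilon> \<and>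
       (\<forall>i\<in>{1..N}. \<forall>j\<in>{1..N}. \<alpha>\<^sub>A (T i j) = (l i \<otimes>\<^bsub>K\<^esub> inv\<^bsub>K\<^esub> (l j)) \<odot>\<^bsub>A\<^esub> T i j) \<and>
       (\<forall>\<beta>\<in>algebra_hom K A A.
          (\<forall>i\<in>{1..N}. \<forall>j\<in>{1..N}. \<beta> (T i j) = (l i \<otimes>\<^bsub>K\<^esub> inv\<^bsub>K\<^esub> (l j)) \<odot>\<^bsub>A\<^esub> T i j)
          \<longrightarrow> (\<forall>x\<in>carrier A. \<beta> x = \<alpha>\<^sub>A x))) \<and>
      (\<forall>t\<in>carrier (tensor K A A). R t = R (tensor_map K A A \<alpha>\<^sub>A \<alpha>\<^sub>A t)) \<and>
      (\<forall>x\<in>carrier V. tensor_map K A V \<alpha>\<^sub>A \<alpha>\<^sub>V (\<rho> x) = \<rho> (\<alpha>\<^sub>V x)) \<and>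
      (\<forall>t\<in>carrier (tensor K V V).
         tensor_map K V V \<alpha>\<^sub>V \<alpha>\<^sub>V (\<gamma> t) = \<gamma> (tensor_map K V V \<alpha>\<^sub>V \<alpha>\<^sub>V t))"
proof -
  have K: "cring K"
    by (rule domain.axioms(1)[OF field.axioms(1)[OF assms(3)]])
  have V: "module K V"
    by (rule vectorspace.axioms(1)[OF assms(5)])
  interpret K: cring K by fact
  interpret V: vectorspace K V by fact
  let ?S = "v ` {1..N}" and ?V2 = "tensor K V V" and ?t = "pure_tensor K V V"
  have gen: "module.span K V ?S = carrier V" and S: "?S \<subseteq> carrier V"
    using assms(7) by (auto simp: V.basis_def)
  have v: "v i \<in> carrier V" if "i \<in> {1..N}" for i
    using S that by auto
  note constants = assms(9)[unfolded is_structure_constants_def]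
  have c: "c i j m n \<in> carrier K"
    if "i \<in> {1..N}" "j \<in> {1..N}" "m \<in> {1..N}" "n \<in> {1..N}" for i j m n
    using constants that by blast
  interpret frt_scaling K N c l
    by (intro frt_scaling.intro frt_algebra.intro frt_scaling_axioms.intro K c assms(13,14))
  obtain \<alpha> where \<alpha>: "\<alpha> \<in> algebra_hom K (frt K N c) (frt K N c)"
    and \<alpha>_gen: "\<And>i j. i \<in> {1..N} \<Longrightarrow> j \<in> {1..N} \<Longrightarrow>
      \<alpha> (frt_gen K N c i j) = ratio i j \<odot>\<^bsub>frt K N c\<^esub> frt_gen K N c i j"
    by (rule scaling_endomorphism_exists) (rule that)
  interpret frt_scaling_endomorphism K N c l \<alpha>
    by (intro frt_scaling_endomorphism.intro frt_scaling_endomorphism_axioms.intro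
        frt_scaling_axioms \<alpha> \<alpha>_gen)
  have V2: "module K ?V2"
    by (rule tensor_is_module[OF V V])
  have AV: "module K (tensor K A V)"
    unfolding A_def by (rule tensor_is_module[OF A_module V])
  have AV': "module K A"
    unfolding A_def by (rule A_module)
  note \<alpha>V_hom = assms(15) and \<alpha>V_v = assms(16) and \<rho>_hom = assms(17) and \<rho>_v = assms(18)
  have \<alpha>A_hom: "\<alpha> \<in> module_hom K A A"
    unfolding A_def by (rule \<alpha>_hom)
  note \<alpha>\<alpha>AV_hom = tensor_map_hom[OF AV' V AV' V \<alpha>A_hom \<alpha>V_hom]
    and \<alpha>\<alpha>AV_pure = tensor_map_pure[OF AV' V AV' V \<alpha>A_hom \<alpha>V_hom]
  note \<alpha>\<alpha>V_hom = tensor_map_hom[OF V V V V \<alpha>V_hom \<alpha>V_hom]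
    and \<alpha>\<alpha>V_pure = tensor_map_pure[OF V V V V \<alpha>V_hom \<alpha>V_hom]
  have \<alpha>A: "\<alpha> \<in> algebra_hom K A A"
    and \<alpha>A_T: "\<And>i j. i \<in> {1..N} \<Longrightarrow> j \<in> {1..N} \<Longrightarrow> \<alpha> (T i j) = ratio i j \<odot>\<^bsub>A\<^esub> T i j"
    unfolding A_def T_def using \<alpha> \<alpha>_gen by auto
  have T: "\<And>i j. i \<in> {1..N} \<Longrightarrow> j \<in> {1..N} \<Longrightarrow> T i j \<in> carrier A"
    unfolding A_def T_def by (rule T_closed)
  have bialgebra: "\<alpha> \<in> bialgebra_hom K A \<Delta> \<epsilon> A \<Delta> \<epsilon>"
    unfolding A_def by (rule scaling_bialgebra_hom[OF assms(10,11)])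
  have unique: "\<beta> x = \<alpha> x"
    if "\<beta> \<in> algebra_hom K A A"
      "\<forall>i\<in>{1..N}. \<forall>j\<in>{1..N}. \<beta> (T i j) = ratio i j \<odot>\<^bsub>A\<^esub> T i j" "x \<in> carrier A" for \<beta> x
    using that(2) \<alpha>A_T
    by (intro algebra_hom_eqI[OF that(1)[unfolded A_def] \<alpha> _ that(3)[unfolded A_def]])
      (simp add: T_def)
  have form: "R t = R (tensor_map K A A \<alpha> \<alpha> t)" if "t \<in> carrier (tensor K A A)" for t
    using form_scaling[OF assms(10,12)] that by (simp add: A_def)
  have comodule: "tensor_map K A V \<alpha> \<alpha>\<^sub>V (\<rho> x) = \<rho> (\<alpha>\<^sub>V x)" if x: "x \<in> carrier V" for x
  proof (rule gen_set_hom_eqI[OF V AV module_hom_comp[OF \<rho>_hom \<alpha>\<alpha>AV_hom]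
        module_hom_comp[OF \<alpha>V_hom \<rho>_hom] gen _ S x])
    interpret AV: module K "tensor K A V" by (rule AV)
    fix y assume "y \<in> ?S"
    then obtain i where i: "i \<in> {1..N}" and y: "y = v i"
      by auto
    have t: "pure_tensor K A V (T i k) (v k) \<in> carrier (tensor K A V)" if "k \<in> {1..N}" for k
      by (rule pure_tensor_closed[OF AV' V T[OF i that] v[OF that]])
    have "tensor_map K A V \<alpha> \<alpha>\<^sub>V (\<rho> y) =
        (\<Oplus>\<^bsub>tensor K A V\<^esub>k\<in>{1..N}. tensor_map K A V \<alpha> \<alpha>\<^sub>V (pure_tensor K A V (T i k) (v k)))"
      unfolding y \<rho>_v[OF i] using t by (intro module_hom_finsum[OF AV AV \<alpha>\<alpha>AV_hom]) auto
    also have "\<dots> = (\<Oplus>\<^bsub>tensor K A V\<^esub>k\<in>{1..N}. l i \<odot>\<^bsub>tensor K A V\<^esub> pure_tensor K A V (T i k) (v k))"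
    proof (rule AV.M.finsum_cong')
      fix k assume k: "k \<in> {1..N}"
      have "ratio i k \<otimes>\<^bsub>K\<^esub> l k = l i"
        using l_Units[OF k] l_closed[OF i] l_closed[OF k] by (simp add: K.m_assoc)
      then show "tensor_map K A V \<alpha> \<alpha>\<^sub>V (pure_tensor K A V (T i k) (v k)) =
          l i \<odot>\<^bsub>tensor K A V\<^esub> pure_tensor K A V (T i k) (v k)"
        using pure_tensor_smult_smult[OF AV' V ratio_closed[OF i k] l_closed(1)[OF k] T[OF i k] v[OF k]]
        by (simp only: \<alpha>\<alpha>AV_pure[OF T[OF i k] v[OF k]] \<alpha>A_T[OF i k] \<alpha>V_v[OF k])
    qed (use t l_closed[OF i] in auto)
    also have "\<dots> = l i \<odot>\<^bsub>tensor K A V\<^esub> \<rho> (v i)"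
      unfolding \<rho>_v[OF i] using t by (intro AV.finsum_smult[symmetric] l_closed[OF i]) auto
    also have "\<dots> = \<rho> (\<alpha>\<^sub>V y)"
      by (simp only: y \<alpha>V_v[OF i] module_hom_smult[OF \<rho>_hom l_closed(1)[OF i] v[OF i]])
    finally show "tensor_map K A V \<alpha> \<alpha>\<^sub>V (\<rho> y) = \<rho> (\<alpha>\<^sub>V y)" .
  qed
  have \<gamma>_hom: "\<gamma> \<in> module_hom K ?V2 ?V2"
    using assms(8) by (simp add: R_matrix_def)
  have braiding: "tensor_map K V V \<alpha>\<^sub>V \<alpha>\<^sub>V (\<gamma> t) = \<gamma> (tensor_map K V V \<alpha>\<^sub>V \<alpha>\<^sub>V t)"
    if t: "t \<in> carrier ?V2" for t
  proof (rule tensor_gen_set_hom_eqI[OF V V V2 module_hom_comp[OF \<gamma>_hom \<alpha>\<alpha>V_hom]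
        module_hom_comp[OF \<alpha>\<alpha>V_hom \<gamma>_hom] gen S gen S _ t])
    interpret V2: module K ?V2 by (rule V2)
    fix x y assume "x \<in> ?S" "y \<in> ?S"
    then obtain i j where ij: "i \<in> {1..N}" "j \<in> {1..N}" and xy: "x = v i" "y = v j"
      by auto
    have tv: "?t (v m) (v n) \<in> carrier ?V2" if "m \<in> {1..N}" "n \<in> {1..N}" for m n
      by (rule pure_tensor_closed[OF V V v[OF that(1)] v[OF that(2)]])
    have scaled: "tensor_map K V V \<alpha>\<^sub>V \<alpha>\<^sub>V (?t (v m) (v n)) = (l m \<otimes>\<^bsub>K\<^esub> l n) \<odot>\<^bsub>?V2\<^esub> ?t (v m) (v n)"
      if "m \<in> {1..N}" "n \<in> {1..N}" for m n
      using pure_tensor_smult_smult[OF V V] that by (simp only: \<alpha>\<alpha>V_pure v \<alpha>V_v l_closed)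
    have summand: "c i j m n \<odot>\<^bsub>?V2\<^esub> ?t (v m) (v n) \<in> carrier ?V2" if "m \<in> {1..N}" "n \<in> {1..N}" for m n
      using tv[OF that] c[OF ij that] by simp
    have ll: "l i \<otimes>\<^bsub>K\<^esub> l j \<in> carrier K"
      using ij by (simp add: l_closed)
    have \<gamma>_v: "\<gamma> (?t (v i) (v j)) =
        (\<Oplus>\<^bsub>?V2\<^esub>m\<in>{1..N}. \<Oplus>\<^bsub>?V2\<^esub>n\<in>{1..N}. c i j m n \<odot>\<^bsub>?V2\<^esub> ?t (v m) (v n))"
      using constants ij by blast
    define g where "g u = (l i \<otimes>\<^bsub>K\<^esub> l j) \<odot>\<^bsub>?V2\<^esub> u" for u
    have g_hom: "g \<in> module_hom K ?V2 ?V2"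
      unfolding g_def using ll
      by (intro module_homI) (simp_all add: V2.smult_r_distr K.m_comm flip: V2.smult_assoc1)
    (* A term of \<gamma> (v i \<otimes> v j) is multiplied by l m l n on the left hand side of the claim; the
       hypothesis on l makes this the factor l i l j, which is the same for all terms. *)
    have eq: "tensor_map K V V \<alpha>\<^sub>V \<alpha>\<^sub>V (c i j m n \<odot>\<^bsub>?V2\<^esub> ?t (v m) (v n)) =
        g (c i j m n \<odot>\<^bsub>?V2\<^esub> ?t (v m) (v n))" if mn: "m \<in> {1..N}" "n \<in> {1..N}" for m n
    proof -
      have lmn: "l m \<otimes>\<^bsub>K\<^esub> l n \<in> carrier K"
        using mn by (simp add: l_closed)
      have "c i j m n \<otimes>\<^bsub>K\<^esub> (l m \<otimes>\<^bsub>K\<^esub> l n) = (l i \<otimes>\<^bsub>K\<^esub> l j) \<otimes>\<^bsub>K\<^esub> c i j m n"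
        using l_coeff[OF ij mn] K.m_comm[OF c[OF ij mn] lmn] by simp
      then show ?thesis
        unfolding g_def module_hom_smult[OF \<alpha>\<alpha>V_hom c[OF ij mn] tv[OF mn]] scaled[OF mn]
        by (simp only: c[OF ij mn] lmn ll tv[OF mn] flip: V2.smult_assoc1)
    qed
    have "tensor_map K V V \<alpha>\<^sub>V \<alpha>\<^sub>V (\<gamma> (?t x y)) = g (\<gamma> (?t x y))"
      unfolding xy \<gamma>_v
      by (intro module_hom_finsum_eqI[OF V2 V2 \<alpha>\<alpha>V_hom g_hom] V2.M.finsum_closed eq summand Pi_I)
    also have "\<dots> = \<gamma> (tensor_map K V V \<alpha>\<^sub>V \<alpha>\<^sub>V (?t x y))"
      unfolding g_def xy scaled[OF ij] by (rule module_hom_smult[OF \<gamma>_hom ll tv[OF ij], symmetric])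
    finally show "tensor_map K V V \<alpha>\<^sub>V \<alpha>\<^sub>V (\<gamma> (?t x y)) = \<gamma> (tensor_map K V V \<alpha>\<^sub>V \<alpha>\<^sub>V (?t x y))" .
  qed
  show ?thesis
  proof (rule exI[of _ \<alpha>], intro conjI)
    show "\<forall>i\<in>{1..N}. \<forall>j\<in>{1..N}. \<alpha> (T i j) = ratio i j \<odot>\<^bsub>A\<^esub> T i j"
      by (intro ballI \<alpha>A_T)
    show "\<forall>\<beta>\<in>algebra_hom K A A.
        (\<forall>i\<in>{1..N}. \<forall>j\<in>{1..N}. \<beta> (T i j) = ratio i j \<odot>\<^bsub>A\<^esub> T i j)
        \<longrightarrow> (\<forall>x\<in>carrier A. \<beta> x = \<alpha> x)"
      by (intro ballI impI) (rule unique)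
  qed (intro ballI bialgebra form comodule braiding; assumption)+
qed

end
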